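(* Let $q$ be a prime power, let $\mathbf{F}_q$ be the field with $q$ elements, let $\lambda$ be a partition of $n$, and let $\mu=(\mu_1,\ldots,\mu_r)$ be a composition of $n$. Let $u\in GL_n(\mathbf{F}_q)$ be a unipotent element whose Jordan canonical form has type $\lambda$, and let $\mathcal{F}_\mu^\lambda$ be the variety of $\mu$-flags fixed by $u$. Then the number $\mathcal{F}_\mu^\lambda(\mathbf{F}_q)$ of $\mathbf{F}_q$-rational points of $\mathcal{F}_\mu^\lambda$ is $$\mathcal{F}_\mu^\lambda(\mathbf{F}_q)=q^{n(\lambda)}\,\mathcal{P}_{\lambda\mu}(q^{-1}),$$ where $$\mathcal{P}_{\lambda\mu}(t)=\sum_{\{\nu\}}t^{c(\nu)}\prod_{k=1}^{r-1}\prod_{i\ge1}\left[\begin{matrix}\nu_i^{(k+1)}-\nu_{i+1}^{(k)}\\ \nu_i^{(k)}-\nu_{i+1}^{(k)}\end{matrix}\right]_t,\qquad c(\nu)=\sum_{k=0}^{r-1}\sum_{i\ge1}\binom{\nu_i^{(k+1)}-\nu_i^{(k)}}{2},$$ the sum being over all flags of partitions $\nu=\{\emptyset=\nu^{(0)}\subset\nu^{(1)}\subset\cdots\subset\nu^{(r)}=\lambda'\}$ with $|\nu^{(k)}|=\mu_1+\cdots+\mu_k$ for $1\le k\le r$.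
   Context: A $\mu$-flag in an $n$-dimensional vector space $V$ is a sequence of subspaces $V_1\subset V_2\subset\cdots\subset V_r=V$ with $\dim V_i=\mu_1+\cdots+\mu_i$ for $1\le i\le r$; it is fixed by $u$ if $uV_i=V_i$ for all $i$. The $\mathbf{F}_q$-rational points of $\mathcal{F}_\mu^\lambda$ are the $\mu$-flags of subspaces of $\mathbf{F}_q^n$ fixed by $u$. A unipotent element has type $\lambda$ if its Jordan blocks have sizes $\lambda_1,\lambda_2,\ldots$. For a partition $\lambda$, $\lambda'$ is the conjugate partition, $n(\lambda)=\sum_{i\ge1}(i-1)\lambda_i=\sum_{i\ge1}\binom{\lambda_i'}{2}$, and $\alpha\subset\beta$ for partitions means $\alpha_i\le\beta_i$ for all $i$ (equality allowed). The $t$-binomial coefficient is $\left[\begin{matrix}N\\ m\end{matrix}\right]_t=\frac{(t;t)_N}{(t;t)_m(t;t)_{N-m}}$ for $0\le m\le N$ and $0$ otherwise, with $(t;t)_m=\prod_{j=1}^m(1-t^j)$; it is a polynomial in $t$. *)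

theory Defs
  imports
    "Jordan_Normal_Form.Jordan_Normal_Form"
    "Jordan_Normal_Form.VS_Connect"
begin

section \<open>Partitions\<close>

definition is_partition :: "nat list \<Rightarrow> bool" where
  "is_partition p \<longleftrightarrow> sorted_wrt (\<ge>) p \<and> 0 \<notin> set p"

text \<open>Parts are indexed from 1 and vanish beyond the length.\<close>

definition nth_part :: "nat list \<Rightarrow> nat \<Rightarrow> nat" where
  "nth_part p i = (if 1 \<le> i \<and> i \<le> length p then p ! (i - 1) else 0)"

definition conj_partition :: "nat list \<Rightarrow> nat list" where
  "conj_partition p = map (\<lambda>i. length (filter (\<lambda>x. i \<le> x) p)) [1..<Suc (nth_part p 1)]"

definition part_contained :: "nat list \<Rightarrow> nat list \<Rightarrow> bool" where
  "part_contained p p' \<longleftrightarrow> (\<forall>i\<ge>1. nth_part p i \<le> nth_part p' i)"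

definition n_stat :: "nat list \<Rightarrow> nat" where
  "n_stat p = (\<Sum>i = 1..length p. (i - 1) * nth_part p i)"


section \<open>The t-binomial coefficient as a polynomial in t\<close>

definition t_poch :: "nat \<Rightarrow> rat poly" where
  "t_poch m = (\<Prod>j = 1..m. 1 - monom 1 j)"

text \<open>The polynomial division is exact, see \<open>t_binomial_exact\<close> below.\<close>

definition t_binomial :: "nat \<Rightarrow> nat \<Rightarrow> rat poly" where
  "t_binomial N m = (if m \<le> N then t_poch N div (t_poch m * t_poch (N - m)) else 0)"

lemma t_poch_Suc: "t_poch (Suc m) = t_poch m * (1 - monom 1 (Suc m))"
  by (simp add: t_poch_def)

lemma t_poch_nonzero: "t_poch m \<noteq> 0"
proof -
  have "1 - monom 1 j \<noteq> (0 :: rat poly)" if "1 \<le> j" for j :: nat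
  proof
    assume "1 - monom 1 j = (0 :: rat poly)"
    then have "coeff (1 - monom 1 j :: rat poly) 0 = 0" by simp
    with that show False by simp
  qed
  then show ?thesis by (simp add: t_poch_def)
qed

lemma t_poch_dvd: "t_poch a * t_poch b dvd t_poch (a + b)"
proof (induction "a + b" arbitrary: a b)
  case 0
  then show ?case by (simp add: t_poch_def)
next
  case (Suc s)
  show ?case
  proof (cases "a = 0 \<or> b = 0")
    case True
    then show ?thesis by (auto simp: t_poch_def)
  next
    case False
    then obtain a' b' where ab: "a = Suc a'" "b = Suc b'"
      by (meson nat.exhaust)
    with Suc.hyps(2) have s: "s = a' + Suc b'" "s = Suc a' + b'" by auto
    have "t_poch a' * t_poch b dvd t_poch s"
      using Suc.hyps(1)[OF s(1)] s(1) ab by simp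
    then have "t_poch a' * t_poch b * (1 - monom 1 a) dvd t_poch s * (1 - monom 1 a)"
      by (rule mult_dvd_mono) simp
    then have 1: "t_poch a * t_poch b dvd t_poch s * (1 - monom 1 a)"
      unfolding ab(1) t_poch_Suc by (simp only: ac_simps)
    have "t_poch a * t_poch b' dvd t_poch s"
      using Suc.hyps(1)[OF s(2)] s(2) ab by simp
    then have "t_poch a * t_poch b' * (1 - monom 1 b) dvd t_poch s * (1 - monom 1 b)"
      by (rule mult_dvd_mono) simp
    then have "t_poch a * t_poch b dvd t_poch s * (1 - monom 1 b)"
      unfolding ab(2) t_poch_Suc by (simp only: ac_simps)
    then have 2: "t_poch a * t_poch b dvd monom 1 a * (t_poch s * (1 - monom 1 b))"
      by (rule dvd_mult)
    from 1 2 have "t_poch a * t_poch b dvd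
        t_poch s * (1 - monom 1 a) + monom 1 a * (t_poch s * (1 - monom 1 b))"
      by (rule dvd_add)
    also have "\<dots> = t_poch s * (1 - monom 1 a * monom 1 b)"
      by (simp add: algebra_simps)
    also have "\<dots> = t_poch (a + b)"
      using Suc.hyps(2) t_poch_Suc[of s] by (simp add: mult_monom)
    finally show ?thesis .
  qed
qed

lemma t_binomial_exact:
  assumes "m \<le> N"
  shows "t_binomial N m * (t_poch m * t_poch (N - m)) = t_poch N"
  using t_poch_dvd[of m "N - m"] assms by (simp add: t_binomial_def)


section \<open>The polynomial attached to a partition and a composition\<close>

text \<open>
  A flag of partitions is the list of its members for \<open>k = 0, \<dots>, r\<close>,
  where \<open>r = length \<mu>\<close>.
\<close>

definition partition_flags :: "nat list \<Rightarrow> nat list \<Rightarrow> nat list list set" where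
  "partition_flags lam \<mu> =
     {\<nu>. length \<nu> = length \<mu> + 1
        \<and> (\<forall>k\<le>length \<mu>. is_partition (\<nu> ! k))
        \<and> \<nu> ! 0 = []
        \<and> \<nu> ! length \<mu> = conj_partition lam
        \<and> (\<forall>k<length \<mu>. part_contained (\<nu> ! k) (\<nu> ! (k + 1)))
        \<and> (\<forall>k\<in>{1..length \<mu>}. sum_list (\<nu> ! k) = sum_list (take k \<mu>))}"

text \<open>
  In the next two definitions \<open>i\<close> ranges up to the length of the largest member of the flag;
  all further terms of the sum are 0 and all further factors of the product are 1.  For a flag
  of partitions the truncated subtractions on \<open>nat\<close> are true subtractions, since part
  \<open>i + 1\<close> of member \<open>k\<close> is at most its part \<open>i\<close>, which is at most part \<open>i\<close> of member \<open>k + 1\<close>.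
\<close>

definition c_stat :: "nat \<Rightarrow> nat list list \<Rightarrow> nat" where
  "c_stat r \<nu> =
     (\<Sum>k<r. \<Sum>i = 1..length (\<nu> ! r).
        (nth_part (\<nu> ! (k + 1)) i - nth_part (\<nu> ! k) i) choose 2)"

definition flag_poly :: "nat list \<Rightarrow> nat list \<Rightarrow> rat poly" where
  "flag_poly lam \<mu> =
     (\<Sum>\<nu>\<in>partition_flags lam \<mu>.
        monom 1 (c_stat (length \<mu>) \<nu>) *
        (\<Prod>k = 1..<length \<mu>. \<Prod>i = 1..length (\<nu> ! length \<mu>).
           t_binomial (nth_part (\<nu> ! (k + 1)) i - nth_part (\<nu> ! k) (i + 1))
                      (nth_part (\<nu> ! k) i - nth_part (\<nu> ! k) (i + 1))))"


section \<open>Unipotent matrices and fixed flags of subspaces\<close>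

definition unipotent_mat :: "'a :: field mat \<Rightarrow> bool" where
  "unipotent_mat u \<longleftrightarrow>
     (\<exists>k. (u - 1\<^sub>m (dim_row u)) ^\<^sub>m k = 0\<^sub>m (dim_row u) (dim_row u))"

definition has_type :: "'a :: field mat \<Rightarrow> nat list \<Rightarrow> bool" where
  "has_type u lam \<longleftrightarrow> jordan_nf u (map (\<lambda>k. (k, 1)) lam)"

definition subspace_dim :: "nat \<Rightarrow> 'a :: field vec set \<Rightarrow> nat" where
  "subspace_dim n W = vectorspace.dim class_ring (module_vec TYPE('a) n \<lparr>carrier := W\<rparr>)"

text \<open>
  The entry \<open>Vs ! i\<close> is the (i+1)-st subspace of the flag.  Inclusions need not be strict,
  so \<open>\<mu>\<close> may have zero parts.
\<close>

definition mu_flags :: "nat \<Rightarrow> nat list \<Rightarrow> 'a :: field vec set list set" where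
  "mu_flags n \<mu> =
     {Vs. length Vs = length \<mu>
        \<and> (\<forall>i<length \<mu>. subspace class_ring (Vs ! i) (module_vec TYPE('a) n))
        \<and> (\<forall>i. i + 1 < length \<mu> \<longrightarrow> Vs ! i \<subseteq> Vs ! (i + 1))
        \<and> (\<mu> \<noteq> [] \<longrightarrow> last Vs = carrier_vec n)
        \<and> (\<forall>i<length \<mu>. subspace_dim n (Vs ! i) = sum_list (take (i + 1) \<mu>))}"

definition fixed_flags :: "'a :: field mat \<Rightarrow> nat list \<Rightarrow> 'a vec set list set" where
  "fixed_flags u \<mu> =
     {Vs \<in> mu_flags (dim_row u) \<mu>. \<forall>W\<in>set Vs. (\<lambda>v. u *\<^sub>v v) ` W = W}"

end

(* For a nilpotent N on V, record the type of V by the numbers dim (ker N \<inter> N^i V); these are the parts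
of the conjugate lambda' of the Jordan type. The number of N-stable W \<subseteq> V whose type is a given
kappa' is found by induction along W |-> N W: given X = N W and K = W \<inter> ker N, the admissible W are
exactly the relative complements of (X + ker N) / (X + K) in N^-1(X) / (X + K), of which there are
q^(kappa'_2 (lambda'_1 - kappa'_1)), while K runs through a Grassmannian. Hence the number is
  prod_i q^(kappa'_(i+1) (lambda'_i - kappa'_i)) [lambda'_i - kappa'_(i+1), kappa'_i - kappa'_(i+1)]_q.
A flag fixed by u is a chain of subspaces stable under N = u - 1; peeling off its members from the
top and summing over their types gives a sum over flags of partitions. Passing from q to 1/q in the
binomials turns the exponents into nu_i^(k) (nu_i^(k+1) - nu_i^(k)), and since
C(y,2) = C(x,2) + x (y - x) + C(y - x, 2), these telescope to n(lambda) - c(nu). *)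

theory Submission
  imports
    Defs
    "Jordan_Normal_Form.Jordan_Normal_Form_Uniqueness"
    "HOL-Library.Function_Algebras"
begin


section \<open>Counting subspaces over a finite field\<close>

text \<open>Dimensions are coded by cardinalities: \<open>card B = q ^ d * card A\<close> stands for
  dim B/A = d. Each count is then a map with fibres of constant size, and no quotient space is ever
  formed; the price is a finiteness hypothesis on every subspace, because the ambient type will be
  the infinite \<open>nat \<Rightarrow> 'a\<close>. The list in \<open>kernel_type\<close> has the
  kernel of N on V as its head and the type of N V as its tail, so list induction is induction along
  V |-> N V. Nilpotency on V is contained in it, since a finite list has to end at the zero space.
  The exponent kappa'_(i+1) (lambda'_i - kappa'_i) is dim Hom(B/T, T/A) for the spaces of the
  overview: dim B/T is the first part of the type of X, and dim T/A is the codimension of K in ker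
  N. Inverting q in the binomial adds (kappa'_i - kappa'_(i+1)) (lambda'_i - kappa'_i), and the two
  combine to kappa'_i (lambda'_i - kappa'_i). Finiteness also reconciles the two notions of
  stability: u W = W as soon as u W lies in W.\<close>

lemma card_eq_sum_fibres:
  assumes "finite T" "finite D" "f ` D \<subseteq> T"
  shows "card D = (\<Sum>y\<in>T. card {x \<in> D. f x = y})"
  using sum.group[OF assms(2,1,3), of "\<lambda>_. 1::nat"] by simp

lemma card_const_fibres:
  assumes "finite T" "finite D" "f ` D \<subseteq> T" "\<And>y. y \<in> T \<Longrightarrow> card {x \<in> D. f x = y} = c"
  shows "card D = card T * c"
  using card_eq_sum_fibres[OF assms(1-3)] assms(4) by simp

locale finite_field_space = vector_space scale
  for scale :: "'a :: {field, finite} \<Rightarrow> 'b :: ab_group_add \<Rightarrow> 'b" (infixr "*s" 75)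
begin

definition q :: nat where "q = card (UNIV :: 'a set)"

lemma q_ge_2: "q \<ge> 2"
proof -
  have "card {0, 1 :: 'a} \<le> card (UNIV :: 'a set)"
    by (rule card_mono) auto
  then show ?thesis by (simp add: q_def)
qed

lemma q_pos [simp]: "q > 0" "q \<noteq> 0"
  using q_ge_2 by auto

definition ssum :: "'b set \<Rightarrow> 'b set \<Rightarrow> 'b set" where
  "ssum A B = {x + y | x y. x \<in> A \<and> y \<in> B}"

lemma ssumI: "x \<in> A \<Longrightarrow> y \<in> B \<Longrightarrow> x + y \<in> ssum A B"
  by (auto simp: ssum_def)

lemma subspace_ssum: "subspace A \<Longrightarrow> subspace B \<Longrightarrow> subspace (ssum A B)"
  unfolding ssum_def by (rule subspace_sums)

lemma ssum_upper1: "subspace B \<Longrightarrow> A \<subseteq> ssum A B"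
  using ssumI[of _ A 0 B] subspace_0[of B] by auto

lemma ssum_upper2: "subspace A \<Longrightarrow> B \<subseteq> ssum A B"
  using ssumI[of 0 A _ B] subspace_0[of A] by auto

lemma ssum_least: "subspace C \<Longrightarrow> A \<subseteq> C \<Longrightarrow> B \<subseteq> C \<Longrightarrow> ssum A B \<subseteq> C"
  by (auto simp: ssum_def intro: subspace_add)

lemma finite_ssum: "finite A \<Longrightarrow> finite B \<Longrightarrow> finite (ssum A B)"
proof -
  assume "finite A" "finite B"
  then have "finite ((\<lambda>(x, y). x + y) ` (A \<times> B))" by simp
  moreover have "ssum A B = (\<lambda>(x, y). x + y) ` (A \<times> B)"
    by (auto simp: ssum_def)
  ultimately show ?thesis by simp
qed

text \<open>Counting form of the dimension formula: the fibre of addition over a + b is a copy of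
  the intersection, through d |-> (a + d, b - d).\<close>

lemma card_ssum:
  assumes A: "subspace A" "finite A" and B: "subspace B" "finite B"
  shows "card A * card B = card (ssum A B) * card (A \<inter> B)"
proof -
  have "card (A \<times> B) = card (ssum A B) * card (A \<inter> B)"
  proof (rule card_const_fibres[where f = "\<lambda>(x, y). x + y"])
    show "finite (ssum A B)" using A B by (simp add: finite_ssum)
    show "finite (A \<times> B)" using A B by simp
    show "(\<lambda>(x, y). x + y) ` (A \<times> B) \<subseteq> ssum A B" by (auto intro: ssumI)
    fix y assume "y \<in> ssum A B"
    then obtain a b where ab: "a \<in> A" "b \<in> B" "y = a + b" by (auto simp: ssum_def)
    have "bij_betw (\<lambda>d. (a + d, b - d)) (A \<inter> B) {p \<in> A \<times> B. (case p of (x, z) \<Rightarrow> x + z) = y}"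
    proof (rule bij_betwI[where g = "\<lambda>p. fst p - a"])
      show "(\<lambda>d. (a + d, b - d)) \<in> A \<inter> B \<rightarrow> {p \<in> A \<times> B. (case p of (x, z) \<Rightarrow> x + z) = y}"
        using ab A B by (auto intro: subspace_add subspace_diff)
      have "x - a \<in> B" if "x \<in> A" "z \<in> B" "x + z = a + b" for x z
      proof -
        have "x - a = b - z" using that(3) by (simp add: algebra_simps)
        then show ?thesis using that ab B by (auto intro: subspace_diff)
      qed
      then show "(\<lambda>p. fst p - a) \<in> {p \<in> A \<times> B. (case p of (x, z) \<Rightarrow> x + z) = y} \<rightarrow> A \<inter> B"
        using ab A by (auto intro: subspace_diff)
    next
      fix p assume "p \<in> {p \<in> A \<times> B. (case p of (x, z) \<Rightarrow> x + z) = y}"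
      then show "(a + (fst p - a), b - (fst p - a)) = p"
        using ab by (cases p) (auto simp: algebra_simps)
    qed auto
    then show "card {p \<in> A \<times> B. (case p of (x, z) \<Rightarrow> x + z) = y} = card (A \<inter> B)"
      by (simp add: bij_betw_same_card)
  qed
  then show ?thesis by (simp add: card_cartesian_product)
qed

lemma span_insert_subspace: "subspace S \<Longrightarrow> span (insert b S) = {x. \<exists>k. x - k *s b \<in> S}"
  by (simp add: span_insert span_eq_iff[THEN iffD2])

lemma scale_in_subspace_iff: "subspace S \<Longrightarrow> k *s b \<in> S \<longleftrightarrow> k = 0 \<or> b \<in> S"
  using subspace_scale[of S "k *s b" "inverse k"] subspace_scale[of S b k] subspace_0[of S]
  by (cases "k = 0") auto

lemma card_span_insert:
  assumes S: "subspace S" "finite S" and b: "b \<notin> S"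
  shows "finite (span (insert b S))" "card (span (insert b S)) = q * card S"
proof -
  let ?f = "\<lambda>(s, k). s + k *s b"
  have im: "?f ` (S \<times> UNIV) = span (insert b S)"
    unfolding span_insert_subspace[OF S(1)]
  proof (intro equalityI subsetI)
    fix x assume "x \<in> {x. \<exists>k. x - k *s b \<in> S}"
    then obtain k where "x - k *s b \<in> S" by auto
    then show "x \<in> ?f ` (S \<times> UNIV)" by (intro image_eqI[of _ _ "(x - k *s b, k)"]) auto
  next
    fix x assume "x \<in> ?f ` (S \<times> UNIV)"
    then obtain s k where "s \<in> S" "x = s + k *s b" by auto
    then show "x \<in> {x. \<exists>k. x - k *s b \<in> S}" by (auto intro!: exI[of _ k])
  qed
  have "inj_on ?f (S \<times> UNIV)"
  proof (rule inj_onI, clarify)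
    fix s k s' k' assume s: "s \<in> S" "s' \<in> S" and eq: "s + k *s b = s' + k' *s b"
    have "(k - k') *s b = s' - s"
      using eq by (simp add: scale_left_diff_distrib algebra_simps)
    moreover have "s' - s \<in> S" using s S by (auto intro: subspace_diff)
    ultimately have "k = k'" using b scale_in_subspace_iff[OF S(1), of "k - k'" b] by auto
    then show "s = s' \<and> k = k'" using eq by simp
  qed
  from card_image[OF this] show "card (span (insert b S)) = q * card S"
    by (simp add: im q_def card_cartesian_product)
  show "finite (span (insert b S))"
    unfolding im[symmetric] using S by simp
qed

section \<open>Sizes and indices of subspaces as powers of q\<close>

lemma card_subspace_pos: "subspace S \<Longrightarrow> finite S \<Longrightarrow> card S > 0"
  using subspace_0[of S] by (auto simp: card_gt_0_iff)

text \<open>Adjoining one vector of T outside S multiplies the size by q, so the gap to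
  \<open>card T\<close> shrinks and the process ends at T.\<close>

lemma subspace_index_power:
  assumes "subspace S" "subspace T" "S \<subseteq> T" "finite T"
  shows "\<exists>d. card T = q ^ d * card S"
  using assms
proof (induction "card T - card S" arbitrary: S rule: less_induct)
  case less
  note fin = finite_subset[OF less.prems(3,4)]
  show ?case
  proof (cases "S = T")
    case True
    then show ?thesis by (auto intro: exI[of _ 0])
  next
    case False
    then obtain b where b: "b \<in> T" "b \<notin> S" using less.prems by auto
    let ?S = "span (insert b S)"
    note c = card_span_insert[OF less.prems(1) fin b(2)]
    have sub: "?S \<subseteq> T" using b less.prems by (intro span_minimal) auto
    have "card S < card ?S"
      using c card_subspace_pos[OF less.prems(1) fin] q_ge_2 by simp
    moreover have "card ?S \<le> card T" using sub less.prems by (auto intro: card_mono)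
    ultimately have "card T - card ?S < card T - card S" by linarith
    then obtain d where "card T = q ^ d * card ?S"
      using less.hyps[of ?S] sub less.prems by auto
    then show ?thesis using c by (intro exI[of _ "Suc d"]) simp
  qed
qed

lemma card_subspace_power:
  assumes "subspace S" "finite S"
  shows "\<exists>d. card S = q ^ d"
  using subspace_index_power[OF subspace_single_0 assms(1)] assms subspace_0 by simp

text \<open>Supplies the hyperplane on which the Grassmannian count is based.\<close>

lemma subspace_between:
  assumes "subspace S" "subspace T" "S \<subseteq> T" "finite T" "card T = q ^ d * card S" "e \<le> d"
  shows "\<exists>H. subspace H \<and> S \<subseteq> H \<and> H \<subseteq> T \<and> card H = q ^ e * card S"
  using assms(6)
proof (induction e)
  case 0
  then show ?case using assms by (intro exI[of _ S]) simp
next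
  case (Suc e)
  then obtain H where H: "subspace H" "S \<subseteq> H" "H \<subseteq> T" "card H = q ^ e * card S" by auto
  have "q ^ e < q ^ d" using Suc.prems q_ge_2 by simp
  then have "card H \<noteq> card T"
    using H(4) assms card_subspace_pos[OF assms(1) finite_subset[OF assms(3,4)]] by simp
  then have "H \<noteq> T" by auto
  then obtain b where b: "b \<in> T" "b \<notin> H" using H(3) by auto
  note c = card_span_insert[OF H(1) finite_subset[OF H(3) assms(4)] b(2)]
  have "span (insert b H) \<subseteq> T" using b H assms by (intro span_minimal) auto
  then show ?case
    using H c span_superset[of "insert b H"] by (intro exI[of _ "span (insert b H)"]) auto
qed


text \<open>Subspaces \<open>W\<close> of \<open>B\<close> such that \<open>W / A\<close> is a complement of \<open>T / A\<close> in \<open>B / A\<close>.\<close>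

definition rel_compl :: "'b set \<Rightarrow> 'b set \<Rightarrow> 'b set \<Rightarrow> 'b set set" where
  "rel_compl A T B = {W. subspace W \<and> W \<inter> T = A \<and> ssum W T = B}"

lemma rel_complD:
  assumes "W \<in> rel_compl A T B" "subspace T"
  shows "subspace W" "W \<inter> T = A" "ssum W T = B" "A \<subseteq> W" "W \<subseteq> B"
  using assms ssum_upper1[of T W] by (auto simp: rel_compl_def)

lemma finite_rel_compl: "finite B \<Longrightarrow> subspace T \<Longrightarrow> finite (rel_compl A T B)"
  by (rule finite_subset[of _ "Pow B"]) (auto dest: rel_complD)

lemma card_rel_complD:
  assumes "W \<in> rel_compl A T B" "subspace T" "finite B"
  shows "card W * card T = card B * card A"
proof -
  note W = rel_complD[OF assms(1,2)]
  have "T \<subseteq> B" using W ssum_upper2[of W T] by auto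
  then show ?thesis
    using card_ssum[OF W(1) _ assms(2)] W(2,3,5) assms(3) by (auto dest: finite_subset)
qed

text \<open>With T of codimension one, every complement is spanned over A by some b + t with t in T,
  and t matters only modulo A: the complements are a torsor under T/A. The product form avoids
  division.\<close>

lemma card_rel_compl_step:
  assumes A: "subspace A" "A \<subseteq> T" and T: "subspace T" "finite T" and b: "b \<notin> T"
  shows "card T = card (rel_compl A T (span (insert b T))) * card A"
proof (rule card_const_fibres[where f = "\<lambda>t. span (insert (b + t) A)"])
  let ?T = "span (insert b T)"
  note fin = card_span_insert(1)[OF T b]
  show "finite (rel_compl A T ?T)" using finite_rel_compl[OF fin T(1)] .
  show "finite T" by (rule T(2))
  show "(\<lambda>t. span (insert (b + t) A)) ` T \<subseteq> rel_compl A T ?T"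
  proof clarify
    fix t assume t: "t \<in> T"
    let ?W = "span (insert (b + t) A)"
    have memW: "x \<in> ?W \<longleftrightarrow> (\<exists>k. x - k *s (b + t) \<in> A)" for x
      by (simp add: span_insert_subspace[OF A(1)])
    have "x \<in> A" if x: "x \<in> ?W" "x \<in> T" for x
    proof -
      obtain k where k: "x - k *s (b + t) \<in> A" using x memW by auto
      have "k *s b = x - (x - k *s (b + t)) - k *s t" by (simp add: algebra_simps)
      also have "\<dots> \<in> T" using k A x t T by (blast intro: subspace_diff subspace_scale)
      finally have "k = 0" using b T scale_in_subspace_iff by auto
      then show ?thesis using k by simp
    qed
    moreover have "A \<subseteq> ?W" by (meson dual_order.trans span_superset subset_insertI)
    ultimately have 1: "?W \<inter> T = A" using A by auto
    have "b + t \<in> ?T"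
      using t by (intro span_add) (auto intro: span_base)
    moreover have "A \<subseteq> ?T" using A span_superset[of "insert b T"] by auto
    ultimately have "?W \<subseteq> ?T" by (intro span_minimal) auto
    moreover have "T \<subseteq> ?T" using span_superset[of "insert b T"] by auto
    ultimately have "ssum ?W T \<subseteq> ?T" by (intro ssum_least) auto
    moreover have "?T \<subseteq> ssum ?W T"
    proof
      fix x assume "x \<in> ?T"
      then obtain k where k: "x - k *s b \<in> T" by (auto simp: span_insert_subspace[OF T(1)])
      have "k *s (b + t) + (x - k *s b - k *s t) \<in> ssum ?W T"
        using k t T by (intro ssumI) (auto intro: subspace_diff subspace_scale span_base span_scale)
      then show "x \<in> ssum ?W T" by (simp add: algebra_simps)
    qed
    ultimately show "?W \<in> rel_compl A T ?T"
      using 1 by (auto simp: rel_compl_def)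
  qed
  fix W assume W: "W \<in> rel_compl A T ?T"
  note WD = rel_complD[OF W T(1)]
  have "b \<in> ssum W T" unfolding WD by (auto intro: span_base)
  then obtain w t0 where w: "w \<in> W" "t0 \<in> T" "b = w + t0" by (auto simp: ssum_def)
  have W_eq: "W = span (insert w A)"
  proof
    show "span (insert w A) \<subseteq> W" using w WD by (intro span_minimal) auto
    show "W \<subseteq> span (insert w A)"
    proof
      fix x assume x: "x \<in> W"
      then have "x \<in> ?T" using WD by auto
      then obtain k where k: "x - k *s b \<in> T" by (auto simp: span_insert_subspace[OF T(1)])
      have "x - k *s w = (x - k *s b) + k *s t0" using w by (simp add: algebra_simps)
      also have "\<dots> \<in> T" using k w T by (auto intro: subspace_add subspace_scale)
      finally have "x - k *s w \<in> T" .
      moreover have "x - k *s w \<in> W" using x w WD by (auto intro: subspace_diff subspace_scale)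
      ultimately show "x \<in> span (insert w A)"
        using WD by (auto simp: span_insert_subspace[OF A(1)])
    qed
  qed
  \<comment> \<open>As b + t = w + (t0 + t) and W meets T in A, the vector b + t spans W over A
    exactly when t0 + t lies in A.\<close>
  have "{t \<in> T. span (insert (b + t) A) = W} = (\<lambda>a. a - t0) ` A"
  proof (intro equalityI subsetI)
    fix t assume "t \<in> {t \<in> T. span (insert (b + t) A) = W}"
    then have t: "t \<in> T" and eq: "span (insert (b + t) A) = W" by auto
    have "b + t \<in> span (insert w A)" using eq W_eq by (auto intro: span_base)
    then obtain k where k: "b + t - k *s w \<in> A" by (auto simp: span_insert_subspace[OF A(1)])
    have "(1 - k) *s b = (b + t - k *s w) - t - k *s t0"
      using w by (simp add: algebra_simps)
    also have "\<dots> \<in> T" using k A t w T by (blast intro: subspace_diff subspace_scale)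
    finally have "k = 1" using b T scale_in_subspace_iff by auto
    then have "t + t0 \<in> A" using k w by (simp add: algebra_simps)
    then show "t \<in> (\<lambda>a. a - t0) ` A" by (force simp: image_iff)
  next
    fix t assume "t \<in> (\<lambda>a. a - t0) ` A"
    then obtain a where a: "a \<in> A" "t = a - t0" by auto
    have "b + t - w \<in> span A" using a w by (auto intro: span_base)
    then have "span (insert (b + t) A) = span (insert w A)" by (rule eq_span_insert_eq)
    moreover have "t \<in> T" using a w A T by (auto intro: subspace_diff)
    ultimately show "t \<in> {t \<in> T. span (insert (b + t) A) = W}" using W_eq by simp
  qed
  then show "card {t \<in> T. span (insert (b + t) A) = W} = card A"
    by (simp add: card_image inj_on_def)
qed

text \<open>Complements correspond to linear maps from B/T to T/A, hence the exponent. The induction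
  enlarges T by one vector to T' and maps W to its intersection A' with T'. The fibre over A'
  consists of the complements of T' over A'; T and A grow by one dimension each, so \<open>e\<close>
  stays while \<open>d\<close> drops.\<close>

lemma card_rel_compl:
  assumes "subspace A" "A \<subseteq> T" "subspace T" "T \<subseteq> B" "subspace B" "finite B"
    and "card B = q ^ d * card T" "card T = q ^ e * card A"
  shows "card (rel_compl A T B) = q ^ (d * e)"
  using assms
proof (induction d arbitrary: A T)
  case 0
  then have "T = B" by (simp add: card_subset_eq)
  then have "rel_compl A T B = {A}"
    using 0 ssum_upper2[of A T] ssum_least[of T A T] ssum_upper1[of T]
    by (fastforce simp: rel_compl_def)
  then show ?case by simp
next
  case (Suc d)
  note finT = finite_subset[OF Suc.prems(4,6)]
  note finA = finite_subset[OF Suc.prems(2) finT]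
  have pos: "card T > 0" "card A > 0"
    using card_subspace_pos[of T] card_subspace_pos[of A] Suc.prems finT finA by auto
  have "card T \<noteq> card B"
    using Suc.prems(7) pos q_ge_2 by (auto simp: nat_mult_eq_1_iff)
  then have "T \<noteq> B" by auto
  then obtain b where b: "b \<in> B" "b \<notin> T" using Suc.prems(4) by auto
  define T' where "T' = span (insert b T)"
  note c = card_span_insert[OF Suc.prems(3) finT b(2), folded T'_def]
  have T': "subspace T'" "T \<subseteq> T'" "T' \<subseteq> B"
    using span_superset[of "insert b T"] b Suc.prems span_minimal[of "insert b T" B]
    by (auto simp: T'_def)
  have cB: "card B = q ^ d * card T'" using c Suc.prems(7) by simp
  have c1: "card (rel_compl A T T') = q ^ e"
    using card_rel_compl_step[OF Suc.prems(1-3) finT b(2), folded T'_def] pos Suc.prems(8) by simp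
  have "card (rel_compl A T B) = card (rel_compl A T T') * q ^ (d * e)"
  proof (rule card_const_fibres[where f = "\<lambda>W. W \<inter> T'"])
    show "finite (rel_compl A T T')" "finite (rel_compl A T B)"
      using finite_rel_compl Suc.prems c by auto
    show "(\<lambda>W. W \<inter> T') ` rel_compl A T B \<subseteq> rel_compl A T T'"
    proof clarify
      fix W assume "W \<in> rel_compl A T B"
      note WD = rel_complD[OF this Suc.prems(3)]
      have "T' \<subseteq> ssum (W \<inter> T') T"
      proof
        fix x assume x: "x \<in> T'"
        then obtain w t where w: "w \<in> W" "t \<in> T" "x = w + t"
          using T' WD by (auto simp: ssum_def)
        have "x - t \<in> T'" using x w T' by (blast intro: subspace_diff)
        then have "w \<in> T'" using w by simp
        then show "x \<in> ssum (W \<inter> T') T" using w by (auto intro: ssumI)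
      qed
      then have "ssum (W \<inter> T') T = T'" using T' ssum_least[of T' "W \<inter> T'" T] by auto
      then show "W \<inter> T' \<in> rel_compl A T T'"
        using WD T' by (auto simp: rel_compl_def subspace_inter)
    qed
    fix A' assume A': "A' \<in> rel_compl A T T'"
    note AD = rel_complD[OF A' Suc.prems(3)]
    have "{W \<in> rel_compl A T B. W \<inter> T' = A'} = rel_compl A' T' B"
    proof (intro equalityI subsetI)
      fix W assume "W \<in> {W \<in> rel_compl A T B. W \<inter> T' = A'}"
      then have W: "W \<in> rel_compl A T B" "W \<inter> T' = A'" by auto
      note WD = rel_complD[OF W(1) Suc.prems(3)]
      have "B \<subseteq> ssum W T'" using WD(3) T' by (auto simp: ssum_def)
      moreover have "ssum W T' \<subseteq> B" using WD T' Suc.prems by (intro ssum_least)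
      ultimately show "W \<in> rel_compl A' T' B" using W WD by (auto simp: rel_compl_def)
    next
      fix W assume W: "W \<in> rel_compl A' T' B"
      note WD = rel_complD[OF W T'(1)]
      have "B \<subseteq> ssum W T"
      proof
        fix x assume "x \<in> B"
        then obtain w t' where w: "w \<in> W" "t' \<in> T'" "x = w + t'" using WD by (auto simp: ssum_def)
        then obtain a t where a: "a \<in> A'" "t \<in> T" "t' = a + t" using AD by (auto simp: ssum_def)
        have "(w + a) + t \<in> ssum W T" using w a WD by (intro ssumI) (auto intro: subspace_add)
        then show "x \<in> ssum W T" using w a by (simp add: algebra_simps)
      qed
      moreover have "ssum W T \<subseteq> B" using WD Suc.prems by (intro ssum_least)
      moreover have "W \<inter> T = A" using WD(2) AD(2) T' by auto
      ultimately show "W \<in> {W \<in> rel_compl A T B. W \<inter> T' = A'}"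
        using WD by (auto simp: rel_compl_def)
    qed
    moreover have "card T' = q ^ e * card A'"
    proof -
      have "card A' * card T = card T' * card A"
        using card_rel_complD[OF A' Suc.prems(3)] c by simp
      then have "card A' = q * card A" using c pos by simp
      then show ?thesis using c Suc.prems(8) by simp
    qed
    ultimately show "card {W \<in> rel_compl A T B. W \<inter> T' = A'} = q ^ (d * e)"
      using Suc.IH[OF AD(1) AD(5) T'(1,3) Suc.prems(5,6) cB] by simp
  qed
  then show ?case using c1 by (simp add: power_add)
qed

end

text \<open>The Gaussian binomial given by its q-Pascal rule, in the form that cutting with a
  hyperplane produces. Truncation in \<open>d - m\<close> is harmless: for d < m the factor next to
  it vanishes.\<close>

fun gauss_binomial :: "nat \<Rightarrow> nat \<Rightarrow> nat \<Rightarrow> nat" where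
  "gauss_binomial q d 0 = 1"
| "gauss_binomial q 0 (Suc m) = 0"
| "gauss_binomial q (Suc d) (Suc m) =
     gauss_binomial q d (Suc m) + q ^ (d - m) * gauss_binomial q d m"

lemma gauss_binomial_eq_0: "d < m \<Longrightarrow> gauss_binomial q d m = 0"
  by (induction q d m rule: gauss_binomial.induct) auto

context finite_field_space
begin

definition grassmannian :: "'b set \<Rightarrow> 'b set \<Rightarrow> nat \<Rightarrow> 'b set set" where
  "grassmannian A B m = {U. subspace U \<and> A \<subseteq> U \<and> U \<subseteq> B \<and> card U = q ^ m * card A}"

lemma finite_grassmannian: "finite B \<Longrightarrow> finite (grassmannian A B m)"
  by (rule finite_subset[of _ "Pow B"]) (auto simp: grassmannian_def)

text \<open>Fix a hyperplane H of B containing A. A subspace U either lies in H or meets it in a U'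
  of one dimension less; in the latter case U is a complement of H over U'. Since dim B/H = 1 and
  dim H/U' = d - m, each U' has q^(d - m) such U, which is the Pascal rule.\<close>

lemma card_grassmannian:
  assumes "subspace A" "subspace B" "A \<subseteq> B" "finite B" "card B = q ^ d * card A"
  shows "card (grassmannian A B m) = gauss_binomial q d m"
  using assms(2-)
proof (induction q d m arbitrary: B rule: gauss_binomial.induct)
  case (1 d)
  have "U = A" if "subspace U" "A \<subseteq> U" "U \<subseteq> B" "card U = card A" for U
    using card_subset_eq[of U A] finite_subset[OF that(3) 1(3)] that by auto
  then have "grassmannian A B 0 = {A}" using 1 assms(1) by (auto simp: grassmannian_def)
  then show ?case by simp
next
  case (2 m)
  then have "B = A" using card_subset_eq[of B A] by simp
  moreover have "card A > 0" using assms(1) 2 by (auto intro!: card_subspace_pos dest: finite_subset)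
  moreover have "q ^ Suc m > 1" using q_ge_2 by (intro one_less_power) auto
  ultimately have "grassmannian A B (Suc m) = {}"
    by (auto simp: grassmannian_def)
  then show ?case by simp
next
  case (3 d m)
  have posA: "card A > 0" using assms(1) 3 by (auto intro!: card_subspace_pos dest: finite_subset)
  obtain H where H: "subspace H" "A \<subseteq> H" "H \<subseteq> B" "card H = q ^ d * card A"
    using subspace_between[OF assms(1) 3(3,4,5,6), of d] by auto
  note finH = finite_subset[OF H(3) 3(5)]
  have cB: "card B = q * card H" using H 3(6) by simp
  have posH: "card H > 0" using card_subspace_pos[OF H(1) finH] .
  let ?G = "grassmannian A B (Suc m)"
  let ?N = "{U \<in> ?G. \<not> U \<subseteq> H}"
  have "?G = grassmannian A H (Suc m) \<union> ?N" using H by (auto simp: grassmannian_def)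
  moreover have "grassmannian A H (Suc m) \<inter> ?N = {}" by (auto simp: grassmannian_def)
  moreover have finN: "finite ?N" using finite_grassmannian 3(5) by auto
  ultimately have "card ?G = card (grassmannian A H (Suc m)) + card ?N"
    using card_Un_disjoint[of "grassmannian A H (Suc m)" ?N] finite_grassmannian[OF finH] by simp
  also have "card (grassmannian A H (Suc m)) = gauss_binomial q d (Suc m)"
    by (rule 3(1)) (use H finH in auto)
  also have "card ?N = card (grassmannian A H m) * q ^ (d - m)"
  proof (rule card_const_fibres[where f = "\<lambda>U. U \<inter> H"])
    show "finite (grassmannian A H m)" "finite ?N"
      using finite_grassmannian finH finN by auto
    have sum: "ssum U H = B" if U: "subspace U" "U \<subseteq> B" "\<not> U \<subseteq> H" for U
    proof -
      obtain x where x: "x \<in> U" "x \<notin> H" using U by auto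
      have sub: "ssum U H \<subseteq> B" using U H 3(3) by (intro ssum_least)
      have "span (insert x H) \<subseteq> ssum U H"
        using x U H ssum_upper1[of H U] ssum_upper2[of U H] subspace_ssum
        by (intro span_minimal) auto
      then have "card (span (insert x H)) \<le> card (ssum U H)"
        using finite_subset[OF sub 3(5)] by (intro card_mono) auto
      then have "card B \<le> card (ssum U H)"
        using card_span_insert[OF H(1) finH x(2)] cB by simp
      then show ?thesis using sub 3(5) by (simp add: card_seteq)
    qed
    have nmem: "subspace U" "A \<subseteq> U" "U \<subseteq> B" "ssum U H = B" "card U = q ^ Suc m * card A"
      if "U \<in> ?N" for U
      using that sum by (auto simp: grassmannian_def)
    show "(\<lambda>U. U \<inter> H) ` ?N \<subseteq> grassmannian A H m"
    proof
      fix U' assume "U' \<in> (\<lambda>U. U \<inter> H) ` ?N"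
      then obtain U where U: "U \<in> ?N" "U' = U \<inter> H" by auto
      note UD = nmem[OF U(1)]
      have "card U * card H = card B * card (U \<inter> H)"
        using card_ssum[OF UD(1) finite_subset[OF UD(3) 3(5)] H(1) finH] UD(4) by simp
      then have "card (U \<inter> H) = q ^ m * card A"
        using cB UD(5) posH by simp
      then show "U' \<in> grassmannian A H m"
        using U(2) UD H by (auto simp: grassmannian_def subspace_inter)
    qed
    fix U' assume "U' \<in> grassmannian A H m"
    then have U': "subspace U'" "A \<subseteq> U'" "U' \<subseteq> H" "card U' = q ^ m * card A"
      by (auto simp: grassmannian_def)
    have "card U' \<le> card H" by (rule card_mono[OF finH U'(3)])
    then have "q ^ m \<le> q ^ d" using U' H posA by simp
    then have md: "m \<le> d" using q_ge_2 by simp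
    have eq: "{U \<in> ?N. U \<inter> H = U'} = rel_compl U' H B"
    proof (intro equalityI subsetI)
      fix U assume U: "U \<in> {U \<in> ?N. U \<inter> H = U'}"
      then show "U \<in> rel_compl U' H B" using nmem[of U] by (auto simp: rel_compl_def)
    next
      fix U assume U: "U \<in> rel_compl U' H B"
      note UD = rel_complD[OF U H(1)]
      have "card U * card H = card B * card U'"
        using card_rel_complD[OF U H(1) 3(5)] .
      then have "card U = q ^ Suc m * card A" using cB U' posH by simp
      moreover have "\<not> U \<subseteq> H"
      proof
        assume "U \<subseteq> H"
        then have "ssum U H \<subseteq> H" using H by (intro ssum_least) auto
        then have "card B \<le> card H" using UD finH by (auto intro: card_mono)
        then show False using cB posH q_ge_2 by simp
      qed
      ultimately show "U \<in> {U \<in> ?N. U \<inter> H = U'}"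
        using UD U' by (auto simp: grassmannian_def)
    qed
    have "q ^ d = q ^ (d - m) * q ^ m" using md by (simp flip: power_add)
    then have "card H = q ^ (d - m) * card U'" using H U' by simp
    with eq show "card {U \<in> ?N. U \<inter> H = U'} = q ^ (d - m)"
      using card_rel_compl[OF U'(1,3) H(1,3) 3(3,5), of 1 "d - m"] cB by simp
  qed
  also have "card (grassmannian A H m) = gauss_binomial q d m"
    by (rule 3(2)) (use H finH in auto)
  finally show ?case by simp
qed

end


section \<open>Submodules of a given type\<close>

definition hd0 :: "nat list \<Rightarrow> nat" where
  "hd0 p = (case p of [] \<Rightarrow> 0 | a # _ \<Rightarrow> a)"

lemma hd0_simps [simp]: "hd0 [] = 0" "hd0 (a # p) = a"
  by (simp_all add: hd0_def)

text \<open>Containment of partitions, not the dominance order, written as a recursion on lists that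
  runs in parallel with \<open>kernel_type\<close>.\<close>

fun dominated :: "nat list \<Rightarrow> nat list \<Rightarrow> bool" where
  "dominated [] p \<longleftrightarrow> True"
| "dominated (b # k) [] \<longleftrightarrow> False"
| "dominated (b # k) (a # p) \<longleftrightarrow> b \<le> a \<and> dominated k p"

text \<open>The classical number of subgroups of given type in a finite abelian p-group, with q for
  p. The ambient type comes first, both types are given by their conjugates, and
  \<open>hd0 k\<close> is the part following \<open>b\<close>.\<close>

fun hall_number :: "nat \<Rightarrow> nat list \<Rightarrow> nat list \<Rightarrow> nat" where
  "hall_number q p [] = 1"
| "hall_number q [] (b # k) = 0"
| "hall_number q (a # p) (b # k) =
     q ^ (hd0 k * (a - b)) * gauss_binomial q (a - hd0 k) (b - hd0 k) * hall_number q p k"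

lemma is_partition_Cons: "is_partition (a # p) \<longleftrightarrow> 0 < a \<and> hd0 p \<le> a \<and> is_partition p"
  by (cases p) (auto simp: is_partition_def)

lemma is_partition_Nil [simp]: "is_partition []"
  by (simp add: is_partition_def)

lemma nth_part_Cons [simp]:
  "nth_part (a # p) (Suc 0) = a" "nth_part (a # p) (Suc (Suc i)) = nth_part p (Suc i)"
  by (auto simp: nth_part_def)

lemma nth_part_Nil [simp]: "nth_part [] i = 0"
  by (simp add: nth_part_def)

lemma part_contained_altdef:
  "part_contained k p \<longleftrightarrow> (\<forall>i. nth_part k (Suc i) \<le> nth_part p (Suc i))"
  unfolding part_contained_def by (auto dest: Suc_le_D)

lemma part_contained_Cons:
  "part_contained (b # k) (a # p) \<longleftrightarrow> b \<le> a \<and> part_contained k p"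
proof
  assume *: "part_contained (b # k) (a # p)"
  then have "nth_part (b # k) (Suc i) \<le> nth_part (a # p) (Suc i)" for i
    by (simp add: part_contained_altdef)
  from this[of 0] this[of "Suc _"] show "b \<le> a \<and> part_contained k p"
    by (simp add: part_contained_altdef)
next
  assume *: "b \<le> a \<and> part_contained k p"
  show "part_contained (b # k) (a # p)"
    unfolding part_contained_altdef
  proof
    fix i show "nth_part (b # k) (Suc i) \<le> nth_part (a # p) (Suc i)"
      using * by (cases i) (auto simp: part_contained_altdef)
  qed
qed

lemma part_contained_iff_dominated:
  "is_partition k \<Longrightarrow> part_contained k p \<longleftrightarrow> dominated k p"
proof (induction k p rule: dominated.induct)
  case (2 b k)
  then have "nth_part (b # k) 1 > nth_part [] 1" by (simp add: is_partition_Cons)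
  then show ?case by (auto simp: part_contained_def not_le intro!: exI[of _ 1])
next
  case (1 p)
  then show ?case by (simp add: part_contained_def)
next
  case (3 b k a p)
  then show ?case by (simp add: part_contained_Cons is_partition_Cons)
qed

lemma nth_chain_mono:
  assumes "\<And>i. Suc i < n \<Longrightarrow> Vs ! i \<subseteq> Vs ! Suc i" "i \<le> j" "j < n"
  shows "Vs ! i \<subseteq> Vs ! j"
  using assms(2,3) 
proof (induction j rule: dec_induct)
  case (step j)
  then show ?case using assms(1)[of j] by auto
qed simp

text \<open>A sum over an infinite index set would be 0 by convention. Parts are positive, so the
  size of a member bounds its length as well as its entries.\<close>

lemma finite_partition_flags: "finite (partition_flags lam \<mu>)"
proof -
  let ?n = "sum_list \<mu> + sum_list (conj_partition lam)"
  let ?P = "{p. set p \<subseteq> {..?n} \<and> length p \<le> ?n}"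
  have "partition_flags lam \<mu> \<subseteq> {\<nu>. set \<nu> \<subseteq> ?P \<and> length \<nu> = length \<mu> + 1}"
  proof clarify
    fix \<nu> assume nu: "\<nu> \<in> partition_flags lam \<mu>"
    have "p \<in> ?P" if p: "p \<in> set \<nu>" for p
    proof -
      obtain i where i: "i \<le> length \<mu>" "p = \<nu> ! i"
        using p nu by (auto simp: partition_flags_def in_set_conv_nth less_Suc_eq_le)
      have "sum_list p \<le> ?n"
      proof (cases "i = 0")
        case False
        then have "sum_list p = sum_list (take i \<mu>)" using i nu by (auto simp: partition_flags_def)
        also have "\<dots> \<le> sum_list (take i \<mu>) + sum_list (drop i \<mu>)" by simp
        also have "\<dots> = sum_list \<mu>" by (simp flip: sum_list_append)
        finally show ?thesis by simp
      qed (use i nu in \<open>auto simp: partition_flags_def\<close>)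
      moreover have "is_partition p" using i nu by (auto simp: partition_flags_def)
      then have "length p \<le> sum_list p" by (induction p) (auto simp: is_partition_Cons)
      moreover have "x \<le> sum_list p" if "x \<in> set p" for x
        using that by (auto intro: member_le_sum_list)
      ultimately show ?thesis by (auto intro: order_trans)
    qed
    then show "set \<nu> \<subseteq> ?P \<and> length \<nu> = length \<mu> + 1"
      using nu by (auto simp: partition_flags_def)
  qed
  moreover have "finite ?P" by (intro finite_lists_length_le) simp
  then have "finite {\<nu>. set \<nu> \<subseteq> ?P \<and> length \<nu> = length \<mu> + 1}" by (rule finite_lists_length_eq)
  ultimately show ?thesis by (rule finite_subset)
qed

section \<open>Stable subspaces of a linear operator and their types\<close>

locale operator_space = finite_field_space scale
  for scale :: "'a :: {field, finite} \<Rightarrow> 'b :: ab_group_add \<Rightarrow> 'b" (infixr "*s" 75) +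
  fixes N :: "'b \<Rightarrow> 'b"
  assumes N_add: "N (x + y) = N x + N y"
    and N_scale: "N (c *s x) = c *s N x"
begin

lemma N_0 [simp]: "N 0 = 0"
  using N_add[of 0 0] by simp

lemma N_diff: "N (x - y) = N x - N y"
  using N_add[of "x - y" y] by (simp add: algebra_simps)

definition ker :: "'b set" where "ker = {x. N x = 0}"

lemma subspace_ker: "subspace ker"
  by (auto simp: subspace_def ker_def N_add N_scale)

lemma subspace_N_image: "subspace S \<Longrightarrow> subspace (N ` S)"
  unfolding subspace_def
proof (intro conjI ballI allI)
  assume S: "0 \<in> S \<and> (\<forall>x\<in>S. \<forall>y\<in>S. x + y \<in> S) \<and> (\<forall>c. \<forall>x\<in>S. c *s x \<in> S)"
  show "0 \<in> N ` S" using S by (intro image_eqI[of _ _ 0]) auto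
  show "x + y \<in> N ` S" if "x \<in> N ` S" "y \<in> N ` S" for x y
    using S that by (auto simp flip: N_add)
  show "c *s x \<in> N ` S" if "x \<in> N ` S" for c x
    using S that by (auto simp flip: N_scale)
qed

lemma card_N_image:
  assumes "subspace S" "finite S"
  shows "card S = card (N ` S) * card (S \<inter> ker)"
proof (rule card_const_fibres[where f = N])
  fix y assume "y \<in> N ` S"
  then obtain x where x: "x \<in> S" "y = N x" by auto
  have "{z \<in> S. N z = y} = (\<lambda>k. x + k) ` (S \<inter> ker)"
  proof (intro equalityI subsetI)
    fix z assume "z \<in> {z \<in> S. N z = y}"
    then show "z \<in> (\<lambda>k. x + k) ` (S \<inter> ker)"
      using x assms by (intro image_eqI[of _ _ "z - x"]) (auto simp: ker_def N_diff intro: subspace_diff)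
  qed (use x assms in \<open>auto simp: ker_def N_add intro: subspace_add\<close>)
  then show "card {z \<in> S. N z = y} = card (S \<inter> ker)" by (simp add: card_image)
qed (use assms in auto)

definition invariant :: "'b set \<Rightarrow> bool" where
  "invariant W \<longleftrightarrow> subspace W \<and> N ` W \<subseteq> W"

lemma invariant_image: "invariant W \<Longrightarrow> invariant (N ` W)"
  by (auto simp: invariant_def subspace_N_image)

lemma invariant_0: "invariant {0}"
  by (simp add: invariant_def)

text \<open>The i-th entry of the list is \<open>dim (ker N \<inter> N\<^sup>i V)\<close>, counted from 0; for nilpotent \<open>N\<close> on \<open>V\<close> this
  is the conjugate of the partition formed by the sizes of the Jordan blocks.\<close>

primrec kernel_type :: "nat list \<Rightarrow> 'b set \<Rightarrow> bool" where
  "kernel_type [] V \<longleftrightarrow> V = {0}"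
| "kernel_type (a # p) V \<longleftrightarrow> V \<noteq> {0} \<and> card (V \<inter> ker) = q ^ a \<and> kernel_type p (N ` V)"

lemma q_power_eq_iff: "q ^ a = q ^ b \<longleftrightarrow> a = b"
  using q_ge_2 by simp

text \<open>The clause \<open>V \<noteq> {0}\<close> fixes where the list stops; without it zeros
  could be appended.\<close>

lemma kernel_type_unique: "kernel_type p V \<Longrightarrow> kernel_type p' V \<Longrightarrow> p = p'"
proof (induction p arbitrary: p' V)
  case Nil
  then show ?case by (cases p') auto
next
  case (Cons a p)
  then show ?case by (cases p') (auto simp: q_power_eq_iff)
qed

lemma card_kernel_type:
  "subspace V \<Longrightarrow> finite V \<Longrightarrow> kernel_type p V \<Longrightarrow> card V = q ^ sum_list p"
proof (induction p arbitrary: V)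
  case (Cons a p)
  then have "card (N ` V) = q ^ sum_list p" by (intro Cons.IH) (auto simp: subspace_N_image)
  then show ?case using card_N_image[of V] Cons.prems by (simp add: power_add)
qed simp

lemma card_kernel_type_ker: "kernel_type p V \<Longrightarrow> card (V \<inter> ker) = q ^ hd0 p"
  by (cases p) (auto simp: ker_def Int_insert_left)

text \<open>This is how nilpotency is used: if N V = V, then every tail of the list is again a type
  of V, down to the empty one.\<close>

lemma kernel_type_image_eq: "kernel_type p V \<Longrightarrow> N ` V = V \<Longrightarrow> V = {0}"
  by (induction p) auto

text \<open>By induction N W has a type contained in that of N V, and the new head b is the
  dimension of W \<inter> ker. It is nonzero because N cannot be bijective on W, at least the next
  part because N W lies in W, and at most a because W lies in V.\<close>

lemma kernel_type_submodule:
  assumes "kernel_type p V" "finite V" "invariant V" "invariant W" "W \<subseteq> V"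
  shows "\<exists>k. kernel_type k W \<and> is_partition k \<and> dominated k p"
  using assms
proof (induction p arbitrary: V W)
  case Nil
  then have "W = {0}" using subspace_0 by (auto simp: invariant_def)
  then show ?case by (intro exI[of _ "[]"]) auto
next
  case (Cons a p)
  show ?case
  proof (cases "W = {0}")
    case True
    then show ?thesis by (intro exI[of _ "[]"]) auto
  next
    case False
    have sW: "subspace W" "N ` W \<subseteq> W" using Cons.prems by (auto simp: invariant_def)
    have fW: "finite W" using Cons.prems by (auto dest: finite_subset)
    have "\<exists>k. kernel_type k (N ` W) \<and> is_partition k \<and> dominated k p"
      by (rule Cons.IH[of "N ` V"]) (use Cons.prems in \<open>auto intro: invariant_image\<close>)
    then obtain k where k: "kernel_type k (N ` W)" "is_partition k" "dominated k p" by auto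
    obtain b where b: "card (W \<inter> ker) = q ^ b"
      using card_subspace_power[of "W \<inter> ker"] fW sW subspace_ker by (auto simp: subspace_inter)
    have "b \<noteq> 0"
    proof
      assume "b = 0"
      then have "card W = card (N ` W)" using card_N_image[OF sW(1) fW] b by simp
      then have "N ` W = W" using sW fW by (intro card_subset_eq) auto
      then show False using kernel_type_image_eq[of k W] k False by simp
    qed
    moreover have "hd0 k \<le> b"
    proof -
      have "card (N ` W \<inter> ker) \<le> card (W \<inter> ker)" using sW fW by (intro card_mono) auto
      then show ?thesis using card_kernel_type_ker[OF k(1)] b q_ge_2 by simp
    qed
    moreover have "b \<le> a"
    proof -
      have "card (W \<inter> ker) \<le> card (V \<inter> ker)" using Cons.prems by (intro card_mono) auto
      then show ?thesis using b Cons.prems q_ge_2 by simp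
    qed
    ultimately show ?thesis
      using k b False by (intro exI[of _ "b # k"]) (auto simp: is_partition_Cons)
  qed
qed

definition submodules :: "nat list \<Rightarrow> 'b set \<Rightarrow> 'b set set" where
  "submodules k V = {W. invariant W \<and> W \<subseteq> V \<and> kernel_type k W}"

lemma finite_submodules: "finite V \<Longrightarrow> finite (submodules k V)"
  by (rule finite_subset[of _ "Pow V"]) (auto simp: submodules_def)

text \<open>Once X lies in W, the condition N W = X says that W and the kernel in V together fill
  the preimage of X, that is W + T = B. By the modular law W \<inter> ker = K becomes W \<inter> T =
  X + K.\<close>

lemma submodules_fibre:
  assumes V: "invariant V" and X: "invariant X" "X \<subseteq> N ` V" "kernel_type k X"
    and K: "subspace K" "X \<inter> ker \<subseteq> K" "K \<subseteq> V \<inter> ker" "card K = q ^ b" "0 < b"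
  shows "{W \<in> submodules (b # k) V. N ` W = X \<and> W \<inter> ker = K} =
           rel_compl (ssum X K) (ssum X (V \<inter> ker)) {v \<in> V. N v \<in> X}"
    (is "?L = rel_compl ?A ?T ?B")
proof (intro equalityI subsetI)
  have sV: "subspace V" "N ` V \<subseteq> V" and sX: "subspace X" "N ` X \<subseteq> X"
    using V X by (auto simp: invariant_def)
  have XV: "X \<subseteq> V" using X sV by auto
  have sVk: "subspace (V \<inter> ker)" using sV subspace_ker by (simp add: subspace_inter)
  have sB: "subspace ?B" using sV sX by (auto simp: subspace_def N_add N_scale)
  have TB: "?T \<subseteq> ?B" using sB sV sX XV subspace_0[OF sX(1)] by (intro ssum_least) (auto simp: ker_def)
  have sT: "subspace ?T" using subspace_ssum sX sVk by simp
  fix W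
  {
    assume "W \<in> ?L"
    then have W: "subspace W" "W \<subseteq> V" "N ` W = X" "W \<inter> ker = K" "X \<subseteq> W"
      by (auto simp: submodules_def invariant_def)
    have "ssum W ?T = ?B"
    proof
      have "W \<subseteq> ?B" using W by auto
      then show "ssum W ?T \<subseteq> ?B" by (rule ssum_least[OF sB _ TB])
      show "?B \<subseteq> ssum W ?T"
      proof
        fix v assume v: "v \<in> ?B"
        then obtain w where w: "w \<in> W" "N v = N w" using W by auto
        have "v - w \<in> V" using v w W sV by (auto intro: subspace_diff)
        moreover have "v - w \<in> ker" using w by (simp add: ker_def N_diff)
        ultimately have "v - w \<in> V \<inter> ker" by simp
        then have "v - w \<in> ?T" using ssum_upper2[OF sX(1), of "V \<inter> ker"] by auto
        then have "w + (v - w) \<in> ssum W ?T" using w by (intro ssumI)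
        then show "v \<in> ssum W ?T" by simp
      qed
    qed
    moreover have "W \<inter> ?T = ?A"
    proof
      show "W \<inter> ?T \<subseteq> ?A"
      proof
        fix w assume w: "w \<in> W \<inter> ?T"
        then obtain x z where xz: "x \<in> X" "z \<in> V \<inter> ker" "w = x + z" by (auto simp: ssum_def)
        have "w - x \<in> W" using w xz W by (blast intro: subspace_diff)
        then have "z \<in> K" using xz W by auto
        then show "w \<in> ?A" using xz by (auto intro: ssumI)
      qed
      have "?A \<subseteq> W" using W by (intro ssum_least) auto
      moreover have "?A \<subseteq> ?T" using K unfolding ssum_def by blast
      ultimately show "?A \<subseteq> W \<inter> ?T" by auto
    qed
    ultimately show "W \<in> rel_compl ?A ?T ?B" using W by (simp add: rel_compl_def)
  next
    assume "W \<in> rel_compl ?A ?T ?B"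
    note W = rel_complD[OF this sT]
    have XW: "X \<subseteq> W" and KW: "K \<subseteq> W"
      using W(4) ssum_upper1[OF K(1), of X] ssum_upper2[OF sX(1), of K] by auto
    have NW: "N ` W = X"
    proof
      show "N ` W \<subseteq> X" using W(5) by auto
      show "X \<subseteq> N ` W"
      proof
        fix x assume x: "x \<in> X"
        then obtain v where v: "v \<in> V" "x = N v" using X by auto
        then have "v \<in> ssum W ?T" using W(3) x by auto
        then obtain w x' z where z: "w \<in> W" "x' \<in> X" "z \<in> ker" "v = w + (x' + z)"
          by (auto simp: ssum_def)
        have "w + x' \<in> W" using z XW W by (auto intro: subspace_add)
        moreover have "x = N (w + x')" using v z by (simp add: N_add ker_def)
        ultimately show "x \<in> N ` W" by blast
      qed
    qed
    have "W \<inter> ker = K"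
    proof
      show "W \<inter> ker \<subseteq> K"
      proof
        fix w assume w: "w \<in> W \<inter> ker"
        then have "w \<in> ?T" using W(5) ssum_upper2[OF sX(1), of "V \<inter> ker"] by auto
        then have "w \<in> ?A" using w W(2) by auto
        then obtain x z where xz: "x \<in> X" "z \<in> K" "w = x + z" by (auto simp: ssum_def)
        \<comment> \<open>This puts x = w - z into X \<inter> ker, which is contained in K by
          hypothesis.\<close>
        have "w - z \<in> ker" using w xz K subspace_ker by (blast intro: subspace_diff)
        then have "x \<in> K" using xz K by auto
        then show "w \<in> K" using xz K by (auto intro: subspace_add)
      qed
      show "K \<subseteq> W \<inter> ker" using KW K by auto
    qed
    \<comment> \<open>Demanded by \<open>kernel_type (b # k) W\<close>; it is here that b > 0
      enters.\<close>
    moreover have "W \<noteq> {0}"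
    proof
      assume "W = {0}"
      then have "K = {0}" using KW subspace_0[OF K(1)] by auto
      then show False using K(4,5) q_ge_2 by (auto simp: eq_commute[of "Suc 0"])
    qed
    ultimately show "W \<in> ?L"
      using NW XW W K X by (auto simp: submodules_def invariant_def)
  }
qed

text \<open>Two nested fibrations, W |-> N W and then W |-> W \<inter> ker, both with fibre sizes
  depending only on the types: c, the first part of the type of X, is the dimension of X \<inter>
  ker.\<close>

theorem card_submodules:
  assumes "invariant V" "finite V" "kernel_type p V" "is_partition k" "dominated k p"
  shows "card (submodules k V) = hall_number q p k"
  using assms
proof (induction k arbitrary: p V)
  case Nil
  have "submodules [] V = {{0}}"
    using Nil invariant_0 subspace_0[of V] by (auto simp: submodules_def invariant_def)
  then show ?case by simp
next
  case (Cons b k)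
  then obtain a p' where p: "p = a # p'" by (cases p) auto
  define c where "c = hd0 k"
  have ab: "b \<le> a" and cb: "c \<le> b" "0 < b" and pk: "is_partition k" "dominated k p'"
    using Cons.prems p by (auto simp: is_partition_Cons c_def)
  have V: "subspace V" "N ` V \<subseteq> V" using Cons.prems by (auto simp: invariant_def)
  have Vk: "subspace (V \<inter> ker)" "finite (V \<inter> ker)" "card (V \<inter> ker) = q ^ a"
    using V subspace_ker Cons.prems p by (auto simp: subspace_inter)
  let ?r = "gauss_binomial q (a - c) (b - c) * q ^ (c * (a - b))"
  have "card (submodules (b # k) V) = card (submodules k (N ` V)) * ?r"
  proof (rule card_const_fibres[where f = "\<lambda>W. N ` W"])
    show "finite (submodules k (N ` V))" "finite (submodules (b # k) V)"
      using Cons.prems by (auto intro: finite_submodules)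
    show "(\<lambda>W. N ` W) ` submodules (b # k) V \<subseteq> submodules k (N ` V)"
      by (auto simp: submodules_def intro: invariant_image)
    fix X assume "X \<in> submodules k (N ` V)"
    then have X: "invariant X" "X \<subseteq> N ` V" "kernel_type k X" by (auto simp: submodules_def)
    then have sX: "subspace X" "N ` X \<subseteq> X" by (auto simp: invariant_def)
    have XV: "X \<subseteq> V" using X V by auto
    have fX: "finite X" using XV Cons.prems by (auto dest: finite_subset)
    have X1: "subspace (X \<inter> ker)" "card (X \<inter> ker) = q ^ c"
      using sX subspace_ker card_kernel_type_ker X by (auto simp: subspace_inter c_def)
    let ?B = "{v \<in> V. N v \<in> X}"
    have B: "subspace ?B" "finite ?B"
      using V sX Cons.prems by (auto simp: subspace_def N_add N_scale)
    have "N ` ?B = X" using X by auto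
    moreover have "?B \<inter> ker = V \<inter> ker" using subspace_0[OF sX(1)] by (auto simp: ker_def)
    ultimately have cB: "card ?B = card X * q ^ a"
      using card_N_image[OF B] Vk by simp
    have "card {W \<in> submodules (b # k) V. N ` W = X} =
        card (grassmannian (X \<inter> ker) (V \<inter> ker) (b - c)) * q ^ (c * (a - b))"
    proof (rule card_const_fibres[where f = "\<lambda>W. W \<inter> ker"])
      show "finite (grassmannian (X \<inter> ker) (V \<inter> ker) (b - c))"
        using Vk by (intro finite_grassmannian)
      show "finite {W \<in> submodules (b # k) V. N ` W = X}"
        using finite_submodules[OF Cons.prems(2)] by simp
      have qb: "q ^ (b - c) * q ^ c = q ^ b" using cb by (simp flip: power_add)
      then show "(\<lambda>W. W \<inter> ker) ` {W \<in> submodules (b # k) V. N ` W = X}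
          \<subseteq> grassmannian (X \<inter> ker) (V \<inter> ker) (b - c)"
        using X1 subspace_ker
        by (auto simp: submodules_def invariant_def grassmannian_def subspace_inter)
      fix K assume "K \<in> grassmannian (X \<inter> ker) (V \<inter> ker) (b - c)"
      then have K: "subspace K" "X \<inter> ker \<subseteq> K" "K \<subseteq> V \<inter> ker" "card K = q ^ b"
        using X1 qb by (auto simp: grassmannian_def)
      have fK: "finite K" using K Vk by (auto dest: finite_subset)
      have "card (rel_compl (ssum X K) (ssum X (V \<inter> ker)) ?B) = q ^ (c * (a - b))"
      proof (rule card_rel_compl)
        show "subspace (ssum X K)" "subspace (ssum X (V \<inter> ker))"
          using sX K Vk by (auto intro: subspace_ssum)
        show "ssum X K \<subseteq> ssum X (V \<inter> ker)" using K unfolding ssum_def by blast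
        show "ssum X (V \<inter> ker) \<subseteq> ?B"
          using B sX XV subspace_0[OF sX(1)] by (intro ssum_least) (auto simp: ker_def)
        \<comment> \<open>Both sums meet X in a space of size q^c. Compared with |B| = |X| q^a this
          gives dim B/T = c and dim T/A = a - b, the factors of the exponent.\<close>
        have "X \<inter> (V \<inter> ker) = X \<inter> ker" "X \<inter> K = X \<inter> ker" using XV K by auto
        then have 1: "card X * q ^ a = card (ssum X (V \<inter> ker)) * q ^ c"
          and 2: "card X * q ^ b = card (ssum X K) * q ^ c"
          using card_ssum[OF sX(1) fX Vk(1,2)] card_ssum[OF sX(1) fX K(1) fK] Vk K X1 by auto
        show "card ?B = q ^ c * card (ssum X (V \<inter> ker))" using cB 1 by simp
        have "q ^ a = q ^ (a - b) * q ^ b" using ab by (simp flip: power_add)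
        then have "card (ssum X (V \<inter> ker)) * q ^ c = q ^ (a - b) * (card X * q ^ b)"
          using 1 by (simp add: ac_simps)
        then show "card (ssum X (V \<inter> ker)) = q ^ (a - b) * card (ssum X K)"
          using 2 by simp
      qed (use B in auto)
      moreover have "{W \<in> {W \<in> submodules (b # k) V. N ` W = X}. W \<inter> ker = K} =
          {W \<in> submodules (b # k) V. N ` W = X \<and> W \<inter> ker = K}" by auto
      ultimately show "card {W \<in> {W \<in> submodules (b # k) V. N ` W = X}. W \<inter> ker = K} =
          q ^ (c * (a - b))"
        using submodules_fibre[OF Cons.prems(1) X K cb(2)] by simp
    qed
    also have "card (grassmannian (X \<inter> ker) (V \<inter> ker) (b - c)) = gauss_binomial q (a - c) (b - c)"
    proof (rule card_grassmannian)
      show "card (V \<inter> ker) = q ^ (a - c) * card (X \<inter> ker)"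
        using Vk X1 ab cb by (simp flip: power_add)
    qed (use X1 Vk XV in auto)
    finally show "card {W \<in> submodules (b # k) V. N ` W = X} = ?r" .
  qed
  also have "card (submodules k (N ` V)) = hall_number q p' k"
    by (rule Cons.IH) (use Cons.prems p pk invariant_image in auto)
  finally show ?case by (simp add: p c_def)
qed

section \<open>Chains of stable subspaces with prescribed types, and flags sorted by type\<close>

definition chains :: "nat list list \<Rightarrow> 'b set \<Rightarrow> 'b set list set" where
  "chains ps V = {Vs. length Vs = length ps \<and>
     (\<forall>i<length ps. invariant (Vs ! i) \<and> kernel_type (ps ! i) (Vs ! i)) \<and>
     (\<forall>i. Suc i < length ps \<longrightarrow> Vs ! i \<subseteq> Vs ! Suc i) \<and> last Vs = V}"

text \<open>Without its top V a chain is a chain below some W; nonemptiness of \<open>ps\<close>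
  guarantees that there is such a W.\<close>

lemma chains_snoc:
  assumes "ps \<noteq> []" "invariant V" "kernel_type p V"
  shows "chains (ps @ [p]) V = (\<Union>W\<in>submodules (last ps) V. (\<lambda>Vs. Vs @ [V]) ` chains ps W)"
proof (intro equalityI subsetI)
  fix Us assume Us: "Us \<in> chains (ps @ [p]) V"
  define Vs where "Vs = butlast Us"
  have "Us \<noteq> []" "last Us = V" using Us by (auto simp: chains_def)
  then have UV: "Us = Vs @ [V]" unfolding Vs_def using append_butlast_last_id[of Us] by simp
  have l: "length Vs = length ps" using Us by (simp add: chains_def UV)
  have *: "invariant (Vs ! i) \<and> kernel_type (ps ! i) (Vs ! i)" if "i < length ps" for i
  proof -
    have "i < length (ps @ [p])" using that by simp
    then have "invariant (Us ! i) \<and> kernel_type ((ps @ [p]) ! i) (Us ! i)"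
      using Us unfolding chains_def by blast
    then show ?thesis using that l by (simp add: UV nth_append)
  qed
  have **: "Vs ! i \<subseteq> Vs ! Suc i" if "Suc i < length ps" for i
  proof -
    have "Suc i < length (ps @ [p])" using that by simp
    then have "Us ! i \<subseteq> Us ! Suc i" using Us unfolding chains_def by blast
    then show ?thesis using that l by (simp add: UV nth_append)
  qed
  have "last Vs \<subseteq> V"
  proof -
    have "Suc (length ps - 1) = length ps" using assms by simp
    moreover have "Suc (length ps - 1) < length (ps @ [p])" using assms(1) by simp
    then have "Us ! (length ps - 1) \<subseteq> Us ! Suc (length ps - 1)"
      using Us unfolding chains_def by blast
    ultimately have "Us ! (length ps - 1) \<subseteq> Us ! length ps" by simp
    then show ?thesis using l assms(1) by (cases "Vs = []") (auto simp: UV nth_append last_conv_nth)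
  qed
  moreover have "invariant (last Vs)" "kernel_type (last ps) (last Vs)"
    using *[of "length ps - 1"] l assms(1) by (cases "Vs = []"; simp add: last_conv_nth)+
  ultimately have "last Vs \<in> submodules (last ps) V" by (simp add: submodules_def)
  moreover have "Vs \<in> chains ps (last Vs)" using * ** l by (simp add: chains_def)
  ultimately show "Us \<in> (\<Union>W\<in>submodules (last ps) V. (\<lambda>Vs. Vs @ [V]) ` chains ps W)"
    using UV by blast
next
  fix Us assume "Us \<in> (\<Union>W\<in>submodules (last ps) V. (\<lambda>Vs. Vs @ [V]) ` chains ps W)"
  then obtain Vs W where UV: "Us = Vs @ [V]" and Vs: "Vs \<in> chains ps W" "W \<subseteq> V"
    by (auto simp: submodules_def)
  then have l: "length Vs = length ps" and W: "W = Vs ! (length ps - 1)"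
    using assms(1) last_conv_nth[of Vs] by (cases "Vs = []"; auto simp: chains_def)+
  show "Us \<in> chains (ps @ [p]) V"
    unfolding chains_def mem_Collect_eq
  proof (intro conjI allI impI)
    fix i assume i: "i < length (ps @ [p])"
    then show "invariant (Us ! i)" "kernel_type ((ps @ [p]) ! i) (Us ! i)"
      using Vs l assms by (cases "i < length ps"; auto simp: UV nth_append chains_def less_Suc_eq)+
  next
    fix i assume i: "Suc i < length (ps @ [p])"
    show "Us ! i \<subseteq> Us ! Suc i"
    proof (cases "Suc i < length ps")
      case True
      then show ?thesis using Vs l by (auto simp: UV nth_append chains_def)
    next
      case False
      then have "i = length ps - 1" "i < length ps" "Suc i = length ps" using i by auto
      then show ?thesis using Vs l W by (auto simp: UV nth_append)
    qed
  qed (auto simp: UV l)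
qed

text \<open>The number of choices for a member depends only on its type and the type of the next
  one, so the count is a product although the subspaces below vary with the choice. Finiteness is
  carried along for the disjoint union over W.\<close>

lemma card_chains:
  assumes "ps \<noteq> []" "invariant V" "finite V" "kernel_type (last ps) V"
    "\<And>i. i < length ps \<Longrightarrow> is_partition (ps ! i)"
    "\<And>i. Suc i < length ps \<Longrightarrow> dominated (ps ! i) (ps ! Suc i)"
  shows "finite (chains ps V) \<and>
    card (chains ps V) = (\<Prod>i<length ps - 1. hall_number q (ps ! Suc i) (ps ! i))"
  using assms
proof (induction ps arbitrary: V rule: rev_nonempty_induct)
  case (single p)
  have "chains [p] V = {[V]}"
    using single by (auto simp: chains_def length_Suc_conv)
  then show ?case by simp
next
  case (snoc p ps)
  have IH: "finite (chains ps W) \<and>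
    card (chains ps W) = (\<Prod>i<length ps - 1. hall_number q (ps ! Suc i) (ps ! i))"
    if "W \<in> submodules (last ps) V" for W
  proof (rule snoc.IH)
    show "invariant W" "kernel_type (last ps) W" "finite W"
      using that snoc.prems by (auto simp: submodules_def dest: finite_subset)
    show "is_partition (ps ! i)" if "i < length ps" for i
      using snoc.prems(4)[of i] that by (simp add: nth_append)
    show "dominated (ps ! i) (ps ! Suc i)" if "Suc i < length ps" for i
      using snoc.prems(5)[of i] that by (simp add: nth_append)
  qed
  have V: "invariant V" "kernel_type p V" using snoc.prems by auto
  have lps: "last ps = ps ! (length ps - 1)" "Suc (length ps - 1) = length ps"
    using snoc.hyps by (auto simp: last_conv_nth)
  have p: "is_partition (last ps)" "dominated (last ps) p"
    using snoc.prems(4)[of "length ps - 1"] snoc.prems(5)[of "length ps - 1"] snoc.hyps lps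
    by (auto simp: nth_append)
  have "card (chains (ps @ [p]) V) =
      (\<Sum>W\<in>submodules (last ps) V. card ((\<lambda>Vs. Vs @ [V]) ` chains ps W))"
    unfolding chains_snoc[OF snoc.hyps V]
  proof (rule card_UN_disjoint)
    show "finite (submodules (last ps) V)" using finite_submodules snoc.prems by simp
    show "\<forall>W\<in>submodules (last ps) V. finite ((\<lambda>Vs. Vs @ [V]) ` chains ps W)" using IH by simp
    show "\<forall>W\<in>submodules (last ps) V. \<forall>W'\<in>submodules (last ps) V. W \<noteq> W' \<longrightarrow>
        (\<lambda>Vs. Vs @ [V]) ` chains ps W \<inter> (\<lambda>Vs. Vs @ [V]) ` chains ps W' = {}"
      by (auto simp: chains_def)
  qed
  also have "\<dots> = (\<Sum>W\<in>submodules (last ps) V. card (chains ps W))"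
    by (simp add: card_image inj_on_def)
  also have "\<dots> = hall_number q p (last ps) * (\<Prod>i<length ps - 1. hall_number q (ps ! Suc i) (ps ! i))"
    using IH card_submodules[OF V(1) snoc.prems(2) V(2) p] by simp
  also have "\<dots> = (\<Prod>i<Suc (length ps - 1). hall_number q ((ps @ [p]) ! Suc i) ((ps @ [p]) ! i))"
  proof -
    have "(ps @ [p]) ! Suc (length ps - 1) = p" "(ps @ [p]) ! (length ps - 1) = last ps"
      using lps snoc.hyps by (auto simp: nth_append)
    moreover have "(ps @ [p]) ! Suc i = ps ! Suc i" "(ps @ [p]) ! i = ps ! i"
      if "i < length ps - 1" for i
      using that by (auto simp: nth_append)
    ultimately show ?thesis by (simp add: mult.commute del: Suc_pred)
  qed
  also have "Suc (length ps - 1) = length (ps @ [p]) - 1" using lps by simp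
  finally have "card (chains (ps @ [p]) V) =
      (\<Prod>i<length (ps @ [p]) - 1. hall_number q ((ps @ [p]) ! Suc i) ((ps @ [p]) ! i))" .
  moreover have "finite (chains (ps @ [p]) V)"
    unfolding chains_snoc[OF snoc.hyps V] using finite_submodules snoc.prems IH by simp
  ultimately show ?case by simp
qed

text \<open>Unlike \<open>fixed_flags\<close>, these lists begin with a member of size 1, the zero
  space, so that indices agree with the partition flags, whose member 0 is empty.\<close>

definition invariant_flags :: "nat list \<Rightarrow> 'b set \<Rightarrow> 'b set list set" where
  "invariant_flags \<mu> V = {Vs. length Vs = Suc (length \<mu>) \<and>
     (\<forall>i\<le>length \<mu>. invariant (Vs ! i) \<and> card (Vs ! i) = q ^ sum_list (take i \<mu>)) \<and>
     (\<forall>i<length \<mu>. Vs ! i \<subseteq> Vs ! Suc i) \<and> last Vs = V}"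

text \<open>Each member of a stable flag has a type, and the sequence of types is a flag of
  partitions: containments come from \<open>kernel_type_submodule\<close>, sizes from
  \<open>card_kernel_type\<close>.\<close>

lemma invariant_flags_eq:
  assumes V: "invariant V" "finite V" "kernel_type (conj_partition lam) V"
  shows "invariant_flags \<mu> V = (\<Union>\<nu>\<in>partition_flags lam \<mu>. chains \<nu> V)"
proof (intro equalityI subsetI)
  fix Vs assume "Vs \<in> invariant_flags \<mu> V"
  then have l: "length Vs = Suc (length \<mu>)" and last: "last Vs = V"
    and inv: "\<And>i. i \<le> length \<mu> \<Longrightarrow> invariant (Vs ! i)"
    and card: "\<And>i. i \<le> length \<mu> \<Longrightarrow> card (Vs ! i) = q ^ sum_list (take i \<mu>)"
    and mono: "\<And>i. i < length \<mu> \<Longrightarrow> Vs ! i \<subseteq> Vs ! Suc i"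
    by (auto simp: invariant_flags_def)
  have last': "Vs ! length \<mu> = V" using l last by (cases "Vs = []") (auto simp: last_conv_nth)
  have sub: "Vs ! i \<subseteq> V" if "i \<le> length \<mu>" for i
    using nth_chain_mono[of "Suc (length \<mu>)" Vs i "length \<mu>"] mono that last' by auto
  have fin: "finite (Vs ! i)" if "i \<le> length \<mu>" for i
    using sub[OF that] V(2) by (rule finite_subset)
  have "\<forall>i\<in>{..length \<mu>}. \<exists>k. kernel_type k (Vs ! i) \<and> is_partition k"
    using kernel_type_submodule[OF V(3,2,1)] inv sub by blast
  then obtain g where g: "\<And>i. i \<le> length \<mu> \<Longrightarrow> kernel_type (g i) (Vs ! i) \<and> is_partition (g i)"
    unfolding bchoice_iff by auto
  define \<nu> where "\<nu> = map g [0..<Suc (length \<mu>)]"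
  have nu: "length \<nu> = Suc (length \<mu>)" "\<And>i. i \<le> length \<mu> \<Longrightarrow> \<nu> ! i = g i"
    by (auto simp: \<nu>_def nth_append simp del: upt_Suc)
  have "part_contained (g i) (g (Suc i))" if i: "i < length \<mu>" for i
  proof -
    \<comment> \<open>Applied to two neighbours, the lemma yields some type of the smaller one
      contained in \<open>g (Suc i)\<close>; uniqueness identifies it with the chosen
      \<open>g i\<close>.\<close>
    obtain k where k: "kernel_type k (Vs ! i)" "is_partition k" "dominated k (g (Suc i))"
      using kernel_type_submodule[of "g (Suc i)" "Vs ! Suc i" "Vs ! i"] g fin inv mono i by force
    then have "k = g i" using kernel_type_unique g i by force
    then show ?thesis using k part_contained_iff_dominated by simp
  qed
  moreover have "g 0 = []"
  proof -
    have "card (Vs ! 0) = 1" using card[of 0] by simp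
    moreover have "0 \<in> Vs ! 0" using inv[of 0] by (auto simp: invariant_def subspace_0)
    ultimately have "Vs ! 0 = {0}" by (auto simp: card_1_singleton_iff)
    then show ?thesis using g[of 0] by (cases "g 0") auto
  qed
  moreover have "g (length \<mu>) = conj_partition lam"
    using g[of "length \<mu>"] V last' kernel_type_unique by auto
  moreover have "sum_list (g i) = sum_list (take i \<mu>)" if "i \<le> length \<mu>" for i
    using card[OF that] card_kernel_type[of "Vs ! i" "g i"] g[OF that] inv[OF that] fin[OF that]
    by (simp add: invariant_def q_power_eq_iff)
  ultimately have "\<nu> \<in> partition_flags lam \<mu>"
    using nu g by (auto simp: partition_flags_def)
  moreover have "Vs \<in> chains \<nu> V"
    using nu g inv mono l last by (auto simp: chains_def)
  ultimately show "Vs \<in> (\<Union>\<nu>\<in>partition_flags lam \<mu>. chains \<nu> V)" by blast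
next
  fix Vs assume "Vs \<in> (\<Union>\<nu>\<in>partition_flags lam \<mu>. chains \<nu> V)"
  then obtain \<nu> where nu: "\<nu> \<in> partition_flags lam \<mu>" "Vs \<in> chains \<nu> V" by blast
  then have l: "length Vs = Suc (length \<mu>)" and last: "last Vs = V"
    and inv: "\<And>i. i \<le> length \<mu> \<Longrightarrow> invariant (Vs ! i) \<and> kernel_type (\<nu> ! i) (Vs ! i)"
    and mono: "\<And>i. i < length \<mu> \<Longrightarrow> Vs ! i \<subseteq> Vs ! Suc i"
    by (auto simp: partition_flags_def chains_def)
  have last': "Vs ! length \<mu> = V" using l last by (cases "Vs = []") (auto simp: last_conv_nth)
  have fin: "finite (Vs ! i)" if "i \<le> length \<mu>" for i
    using nth_chain_mono[of "Suc (length \<mu>)" Vs i "length \<mu>"] mono that last' V(2)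
    by (auto intro: finite_subset)
  have "sum_list (\<nu> ! i) = sum_list (take i \<mu>)" if "i \<le> length \<mu>" for i
    using nu(1) that by (cases "i = 0") (auto simp: partition_flags_def)
  then have "card (Vs ! i) = q ^ sum_list (take i \<mu>)" if "i \<le> length \<mu>" for i
    using card_kernel_type[of "Vs ! i" "\<nu> ! i"] inv[OF that] fin[OF that] that
    by (simp add: invariant_def)
  then show "Vs \<in> invariant_flags \<mu> V"
    using l last inv mono by (auto simp: invariant_flags_def)
qed

theorem card_invariant_flags:
  assumes V: "invariant V" "finite V" "kernel_type (conj_partition lam) V"
  shows "card (invariant_flags \<mu> V) =
    (\<Sum>\<nu>\<in>partition_flags lam \<mu>. \<Prod>i<length \<mu>. hall_number q (\<nu> ! Suc i) (\<nu> ! i))"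
proof -
  have c: "finite (chains \<nu> V) \<and>
      card (chains \<nu> V) = (\<Prod>i<length \<mu>. hall_number q (\<nu> ! Suc i) (\<nu> ! i))"
    if nu: "\<nu> \<in> partition_flags lam \<mu>" for \<nu>
  proof -
    have l: "length \<nu> = Suc (length \<mu>)" using nu by (simp add: partition_flags_def)
    then have "last \<nu> = conj_partition lam"
      using nu by (cases "\<nu> = []") (auto simp: partition_flags_def last_conv_nth)
    then show ?thesis
      using card_chains[of \<nu> V] nu V l part_contained_iff_dominated
      by (cases "\<nu> = []") (auto simp: partition_flags_def)
  qed
  have "card (invariant_flags \<mu> V) = (\<Sum>\<nu>\<in>partition_flags lam \<mu>. card (chains \<nu> V))"
    unfolding invariant_flags_eq[OF V]
  proof (rule card_UN_disjoint)
    show "\<forall>\<nu>\<in>partition_flags lam \<mu>. \<forall>\<nu>'\<in>partition_flags lam \<mu>.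
        \<nu> \<noteq> \<nu>' \<longrightarrow> chains \<nu> V \<inter> chains \<nu>' V = {}"
    proof (intro ballI impI, rule ccontr)
      fix \<nu> \<nu>' assume *: "\<nu> \<noteq> \<nu>'" "chains \<nu> V \<inter> chains \<nu>' V \<noteq> {}"
      then obtain Vs where "Vs \<in> chains \<nu> V" "Vs \<in> chains \<nu>' V" by auto
      then have "length \<nu> = length \<nu>'" "\<And>i. i < length \<nu> \<Longrightarrow> \<nu> ! i = \<nu>' ! i"
        by (auto simp: chains_def intro: kernel_type_unique)
      then have "\<nu> = \<nu>'" by (rule nth_equalityI)
      then show False using * by simp
    qed
  qed (use c finite_partition_flags in auto)
  then show ?thesis using c by simp
qed

end


section \<open>Passing from q to its inverse\<close>

lemma dominated_length: "dominated k p \<Longrightarrow> length k \<le> length p"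
  by (induction k p rule: dominated.induct) auto

lemma prod_atLeast1_atMost_Suc:
  fixes f :: "nat \<Rightarrow> 'a :: comm_monoid_mult"
  shows "(\<Prod>i = 1..Suc L. f i) = f 1 * (\<Prod>i = 1..L. f (Suc i))"
  using prod.atLeast_Suc_atMost[of 1 "Suc L" f] prod.shift_bounds_cl_Suc_ivl[of f 1 L] by simp

lemma nth_part_Cons_Suc: "1 \<le> i \<Longrightarrow> nth_part (a # p) (Suc i) = nth_part p i"
  by (cases i) auto

lemma hd0_eq_nth_part: "hd0 p = nth_part p (Suc 0)"
  by (cases p) auto

text \<open>Turns the factors for k = 0, and those in columns beyond the smaller partition, into
  1.\<close>

lemma t_binomial_0 [simp]: "t_binomial N 0 = 1"
  using t_poch_nonzero[of N] by (simp add: t_binomial_def) (simp add: t_poch_def)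

context
  fixes q :: nat
  assumes q: "q \<ge> 2"
begin

definition q_inv :: rat where "q_inv = 1 / of_nat q"

lemma of_nat_q_q_inv: "of_nat q * q_inv = 1" "q_inv * of_nat q = 1"
  using q by (simp_all add: q_inv_def)

lemma q_power_q_inv_power: "of_nat q ^ (m + k) * q_inv ^ m = of_nat q ^ k"
proof -
  have "of_nat q ^ (m + k) * q_inv ^ m = (of_nat q * q_inv) ^ m * of_nat q ^ k"
    by (simp add: power_add power_mult_distrib)
  then show ?thesis by (simp add: of_nat_q_q_inv)
qed

definition t_poch_at_q_inv :: "nat \<Rightarrow> rat" where "t_poch_at_q_inv m = poly (t_poch m) q_inv"

lemma t_poch_at_q_inv_0 [simp]: "t_poch_at_q_inv 0 = 1" by (simp add: t_poch_at_q_inv_def t_poch_def)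

lemma t_poch_at_q_inv_Suc: "t_poch_at_q_inv (Suc m) = t_poch_at_q_inv m * (1 - q_inv ^ Suc m)"
  by (simp add: t_poch_at_q_inv_def t_poch_Suc poly_monom del: power_Suc)

text \<open>Holds because 0 < 1/q < 1; it permits cancelling the denominators of the t-binomials
  after evaluation.\<close>

lemma t_poch_at_q_inv_nonzero: "t_poch_at_q_inv m \<noteq> 0"
proof (induction m)
  case (Suc m)
  have "q_inv < 1" "0 < q_inv" using q by (auto simp: q_inv_def)
  then have "q_inv ^ Suc m < 1" by (intro power_Suc_less_one)
  then show ?case using Suc t_poch_at_q_inv_Suc by simp
qed simp

text \<open>The inversion [m+e, m]_q = q^(me) [m+e, m]_(1/q), cleared of denominators and free of
  subtraction, so that the Pascal rule can be used by induction on m + e.\<close>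

lemma gauss_binomial_t_poch:
  "of_nat (gauss_binomial q (m + e) m) * (t_poch_at_q_inv m * t_poch_at_q_inv e) = of_nat q ^ (m * e) * t_poch_at_q_inv (m + e)"
proof (induction "m + e" arbitrary: m e)
  case 0
  then show ?case by simp
next
  case (Suc s)
  show ?case
  proof (cases m)
    case 0
    then show ?thesis by (cases e) auto
  next
    case (Suc m')
    note m = this
    show ?thesis
    proof (cases e)
      case 0
      \<comment> \<open>For e = 0 the first Pascal term vanishes by
        \<open>gauss_binomial_eq_0\<close>, and the second is the instance for m'.\<close>
      then have "s = m' + 0" using Suc.hyps(2) m by simp
      from Suc.hyps(1)[OF this] show ?thesis
        using 0 m t_poch_at_q_inv_nonzero[of m'] by (simp add: gauss_binomial_eq_0 t_poch_at_q_inv_Suc)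
    next
      case (Suc e')
      define Q where "Q = (of_nat q :: rat)"
      define A where "A = (of_nat (gauss_binomial q (m' + e) m) :: rat)"
      define B where "B = (of_nat (gauss_binomial q (m' + e) m') :: rat)"
      have s: "s = m + e'" "s = m' + e" using Suc.hyps(2) Suc m by auto
      have IH1: "A * (t_poch_at_q_inv m * t_poch_at_q_inv e') = Q ^ (m * e') * t_poch_at_q_inv s"
        using Suc.hyps(1)[OF s(1)] s unfolding A_def Q_def by simp
      have IH2: "B * (t_poch_at_q_inv m' * t_poch_at_q_inv e) = Q ^ (m' * e) * t_poch_at_q_inv s"
        using Suc.hyps(1)[OF s(2)] s unfolding B_def Q_def by simp
      have ms: "m + e = Suc s" using Suc.hyps(2) by simp
      have "of_nat (gauss_binomial q (m + e) m) = A + Q ^ e * B"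
        using m unfolding A_def B_def Q_def by simp
      then have "of_nat (gauss_binomial q (m + e) m) * (t_poch_at_q_inv m * t_poch_at_q_inv e) =
          A * (t_poch_at_q_inv m * t_poch_at_q_inv e') * (1 - q_inv ^ e) + Q ^ e * (B * (t_poch_at_q_inv m' * t_poch_at_q_inv e)) * (1 - q_inv ^ m)"
        unfolding Suc m by (simp add: t_poch_at_q_inv_Suc algebra_simps del: power_Suc)
      also have "\<dots> = t_poch_at_q_inv s * (Q ^ (m * e') * (1 - q_inv ^ e) + Q ^ (e + m' * e) * (1 - q_inv ^ m))"
        unfolding IH1 IH2 by (simp add: algebra_simps power_add)
      also have "Q ^ (e + m' * e) = Q ^ (m * e)" by (simp add: m algebra_simps)
      \<comment> \<open>As e = e' + 1, the product q^(me) q^(-m) equals q^(me'), so the two terms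
        q^(me') cancel.\<close>
      also have "Q ^ (m * e') * (1 - q_inv ^ e) + Q ^ (m * e) * (1 - q_inv ^ m) =
          Q ^ (m * e) * (1 - q_inv ^ (m + e))"
      proof -
        have "Q ^ (m * e) * q_inv ^ m = Q ^ (m * e')"
          using q_power_q_inv_power[of m "m * e'"] by (simp add: Suc Q_def)
        then have "Q ^ (m * e) * q_inv ^ (m + e) = Q ^ (m * e') * q_inv ^ e"
          by (simp add: power_add flip: mult.assoc)
        with \<open>Q ^ (m * e) * q_inv ^ m = Q ^ (m * e')\<close> show ?thesis by (simp add: algebra_simps)
      qed
      also have "t_poch_at_q_inv s * (Q ^ (m * e) * (1 - q_inv ^ (m + e))) = Q ^ (m * e) * t_poch_at_q_inv (m + e)"
        unfolding ms by (simp add: t_poch_at_q_inv_Suc)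
      finally show ?thesis by (simp add: Q_def)
    qed
  qed
qed

lemma gauss_binomial_t_binomial:
  assumes "m \<le> N"
  shows "of_nat (gauss_binomial q N m) = of_nat q ^ (m * (N - m)) * poly (t_binomial N m) q_inv"
proof -
  have "poly (t_binomial N m) q_inv * (t_poch_at_q_inv m * t_poch_at_q_inv (N - m)) = t_poch_at_q_inv N"
    using arg_cong[OF t_binomial_exact[OF assms], of "\<lambda>p. poly p q_inv"] by (simp add: t_poch_at_q_inv_def)
  then have "of_nat (gauss_binomial q N m) * (t_poch_at_q_inv m * t_poch_at_q_inv (N - m)) =
      of_nat q ^ (m * (N - m)) * poly (t_binomial N m) q_inv * (t_poch_at_q_inv m * t_poch_at_q_inv (N - m))"
    using gauss_binomial_t_poch[of m "N - m"] assms by simp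
  then show ?thesis using t_poch_at_q_inv_nonzero by simp
qed

text \<open>The bound \<open>L\<close> may exceed the length of \<open>p\<close>, so that all steps
  of a flag can share one range of columns; the extra factors are 1.\<close>

lemma hall_number_t_binomial:
  assumes "is_partition k" "dominated k p" "length p \<le> L"
  shows "of_nat (hall_number q p k) =
    (\<Prod>i = 1..L. of_nat q ^ (nth_part k i * (nth_part p i - nth_part k i)) *
       poly (t_binomial (nth_part p i - nth_part k (i + 1)) (nth_part k i - nth_part k (i + 1))) q_inv)"
  using assms
proof (induction k p arbitrary: L rule: dominated.induct)
  case (3 b k a p)
  obtain L' where L: "L = Suc L'" using 3(4) by (cases L) auto
  define c where "c = hd0 k"
  have cba: "c \<le> b" "b \<le> a" using 3 by (auto simp: is_partition_Cons c_def)
  have IH: "of_nat (hall_number q p k) =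
    (\<Prod>i = 1..L'. of_nat q ^ (nth_part k i * (nth_part p i - nth_part k i)) *
       poly (t_binomial (nth_part p i - nth_part k (i + 1)) (nth_part k i - nth_part k (i + 1))) q_inv)"
    by (rule 3(1)) (use 3(2-) L in \<open>auto simp: is_partition_Cons\<close>)
  have ab: "a - c - (b - c) = a - b" using cba by simp
  \<comment> \<open>The first exponent comes from \<open>hall_number\<close>, the second from
    inverting q in the binomial; in their sum c, the next part, disappears.\<close>
  have "c * (a - b) + (b - c) * (a - b) = b * (a - b)"
    using cba by (simp flip: add_mult_distrib)
  then have exp: "(of_nat q :: rat) ^ (c * (a - b)) * of_nat q ^ ((b - c) * (a - b)) = of_nat q ^ (b * (a - b))"
    by (simp flip: power_add)
  have "(of_nat (hall_number q (a # p) (b # k)) :: rat) =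
      of_nat q ^ (c * (a - b)) * of_nat (gauss_binomial q (a - c) (b - c)) * of_nat (hall_number q p k)"
    by (simp add: c_def)
  also have "of_nat (gauss_binomial q (a - c) (b - c)) =
      of_nat q ^ ((b - c) * (a - b)) * poly (t_binomial (a - c) (b - c)) q_inv"
    using gauss_binomial_t_binomial[of "b - c" "a - c"] cba ab by simp
  also have "of_nat q ^ (c * (a - b)) * (of_nat q ^ ((b - c) * (a - b)) * poly (t_binomial (a - c) (b - c)) q_inv) =
      of_nat q ^ (b * (a - b)) * poly (t_binomial (a - c) (b - c)) q_inv"
    by (simp flip: exp)
  finally show ?case
    unfolding L IH prod_atLeast1_atMost_Suc
    by (simp add: c_def hd0_eq_nth_part nth_part_Cons_Suc cong: prod.cong_simp)
qed auto

end

section \<open>Telescoping and conjugate partitions\<close>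

lemma choose_two_split:
  assumes "x \<le> y"
  shows "y choose 2 = (x choose 2) + x * (y - x) + ((y - x) choose 2)"
proof -
  obtain d where "y = x + d" using assms le_Suc_ex by blast
  moreover have "(x + d) choose 2 = (x choose 2) + x * d + (d choose 2)"
    by (induction d) (simp_all add: numeral_2_eq_2 algebra_simps)
  ultimately show ?thesis by simp
qed

lemma choose_two_telescope:
  assumes "\<And>k. k < r \<Longrightarrow> x k \<le> x (Suc k)" "x 0 = (0::nat)"
  shows "x r choose 2 = (\<Sum>k<r. x k * (x (Suc k) - x k)) + (\<Sum>k<r. (x (Suc k) - x k) choose 2)"
  using assms
proof (induction r)
  case (Suc r)
  then show ?case using choose_two_split[of "x r" "x (Suc r)"] by simp
qed simp

section \<open>Column lengths of a partition and the statistic n(lambda)\<close>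

definition count_ge :: "nat list \<Rightarrow> nat \<Rightarrow> nat" where
  "count_ge p j = length (filter (\<lambda>x. j \<le> x) p)"

lemma partition_le_hd0: "is_partition p \<Longrightarrow> x \<in> set p \<Longrightarrow> x \<le> hd0 p"
  by (cases p) (auto simp: is_partition_def)

lemma length_conj_partition: "length (conj_partition p) = hd0 p"
  by (cases p) (auto simp: conj_partition_def)

lemma nth_conj_partition: "i < hd0 p \<Longrightarrow> conj_partition p ! i = count_ge p (Suc i)"
  by (cases p) (auto simp: conj_partition_def count_ge_def simp del: upt_Suc filter.simps)

text \<open>Valid for all columns, since both sides vanish beyond the first part of
  \<open>p\<close>; column sums may thus run to any large bound. Index 0 is excluded: there
  \<open>nth_part\<close> is 0 while \<open>count_ge\<close> is the length.\<close>

lemma nth_part_conj_partition: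
  assumes "is_partition p"
  shows "nth_part (conj_partition p) (Suc i) = count_ge p (Suc i)"
proof (cases "i < hd0 p")
  case True
  then show ?thesis by (simp add: nth_part_def length_conj_partition nth_conj_partition)
next
  case False
  then have "x \<le> i" if "x \<in> set p" for x using partition_le_hd0[OF assms that] by simp
  then have "count_ge p (Suc i) = 0" by (force simp: count_ge_def filter_empty_conv)
  then show ?thesis using False by (simp add: nth_part_def length_conj_partition)
qed

text \<open>Double counting of the cells in the first L columns: a row of length x has
  \<open>min L x\<close> of them.\<close>

lemma sum_count_ge: "(\<Sum>j = 1..L. count_ge p j) = sum_list (map (min L) p)"
proof (induction p)
  case (Cons x p)
  have "(\<Sum>j = 1..L. if j \<le> x then 1 else 0 :: nat) = min L x"
  proof -
    have "{j \<in> {1..L}. j \<le> x} = {1..min L x}" by auto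
    then show ?thesis by (simp flip: sum.inter_filter)
  qed
  moreover have "(\<Sum>j = 1..L. count_ge (x # p) j) =
      (\<Sum>j = 1..L. (if j \<le> x then 1 else 0) + count_ge p j)"
    by (intro sum.cong) (auto simp: count_ge_def)
  ultimately show ?case using Cons by (simp add: sum.distrib)
qed (simp add: count_ge_def)

text \<open>Append the smallest part x below l = \<open>length p\<close> rows. It adds l * x on the
  left; on the right each of the columns 1 to x is full and grows from l to l + 1, and C(l+1, 2) -
  C(l, 2) = l.\<close>

lemma n_stat_eq_sum_choose:
  assumes "sorted_wrt (\<ge>) p" "\<And>x. x \<in> set p \<Longrightarrow> x \<le> L"
  shows "n_stat p = (\<Sum>j = 1..L. count_ge p j choose 2)"
  using assms
proof (induction p rule: rev_induct)
  case Nil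
  then show ?case by (simp add: n_stat_def count_ge_def)
next
  case (snoc x p)
  have x: "x \<le> L" "\<And>y. y \<in> set p \<Longrightarrow> x \<le> y" using snoc.prems by (auto simp: sorted_wrt_append)
  have "n_stat (p @ [x]) = n_stat p + length p * x"
  proof -
    have "(\<Sum>i = 1..length p. (i - 1) * nth_part (p @ [x]) i) = (\<Sum>i = 1..length p. (i - 1) * nth_part p i)"
      by (intro sum.cong) (auto simp: nth_part_def nth_append)
    then show ?thesis unfolding n_stat_def by (simp add: nth_part_def)
  qed
  also have "n_stat p = (\<Sum>j = 1..L. count_ge p j choose 2)"
    by (rule snoc.IH) (use snoc.prems in \<open>auto simp: sorted_wrt_append\<close>)
  also have "length p * x = (\<Sum>j = 1..L. if j \<le> x then length p else 0)"
  proof -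
    have "{j \<in> {1..L}. j \<le> x} = {1..x}" using x by auto
    then show ?thesis by (simp flip: sum.inter_filter)
  qed
  also have "(\<Sum>j = 1..L. count_ge p j choose 2) + \<dots> =
      (\<Sum>j = 1..L. count_ge (p @ [x]) j choose 2)"
    unfolding sum.distrib[symmetric]
  proof (rule sum.cong[OF refl])
    fix j assume "j \<in> {1..L}"
    show "(count_ge p j choose 2) + (if j \<le> x then length p else 0) = count_ge (p @ [x]) j choose 2"
    proof (cases "j \<le> x")
      case True
      then have "filter (\<lambda>y. j \<le> y) p = p" using x by (force simp: filter_id_conv)
      then show ?thesis using True by (simp add: count_ge_def numeral_2_eq_2)
    qed (simp add: count_ge_def)
  qed
  finally show ?case .
qed

text \<open>The right side is the dimension of ker (u - 1)^i for Jordan blocks of sizes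
  \<open>p\<close>; this is the link from the Jordan form to \<open>kernel_type\<close>.\<close>

lemma sum_list_take_conj_partition:
  assumes "is_partition p"
  shows "sum_list (take i (conj_partition p)) = sum_list (map (min i) p)"
proof -
  have "sum_list (take i (conj_partition p)) = (\<Sum>j<min i (hd0 p). conj_partition p ! j)"
    by (simp add: sum_list_sum_nth length_conj_partition lessThan_atLeast0 min.commute)
  also have "\<dots> = (\<Sum>j<min i (hd0 p). count_ge p (Suc j))"
    by (intro sum.cong) (auto simp: nth_conj_partition)
  also have "\<dots> = (\<Sum>j = 1..min i (hd0 p). count_ge p j)"
    by (simp add: sum.atLeast1_atMost_eq)
  also have "\<dots> = sum_list (map (min i) p)"
    unfolding sum_count_ge
  proof (intro arg_cong[of _ _ sum_list] map_cong refl)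
    fix x assume "x \<in> set p"
    then have "x \<le> hd0 p" by (rule partition_le_hd0[OF assms])
    then show "min (min i (hd0 p)) x = min i x" by simp
  qed
  finally show ?thesis .
qed

lemma sum_list_conj_partition:
  assumes "is_partition p"
  shows "sum_list (conj_partition p) = sum_list p"
proof -
  have "sum_list (take (hd0 p) (conj_partition p)) = sum_list (map (min (hd0 p)) p)"
    using assms by (rule sum_list_take_conj_partition)
  also have "map (min (hd0 p)) p = p"
    using partition_le_hd0[OF assms] by (intro map_idI min_absorb2)
  finally show ?thesis by (simp add: length_conj_partition)
qed

lemma conj_partition_pos:
  assumes "is_partition p"
  shows "0 \<notin> set (conj_partition p)"
proof
  assume "0 \<in> set (conj_partition p)"
  then obtain i where i: "i < hd0 p" "count_ge p (Suc i) = 0"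
    by (metis in_set_conv_nth length_conj_partition nth_conj_partition)
  then have "hd0 p \<in> set p" by (cases p) auto
  then show False using i by (force simp: count_ge_def filter_empty_conv)
qed

text \<open>The two sums agree term by term, flag by flag.\<close>

lemma flag_sum_eq:
  assumes q: "q \<ge> 2" and lam: "is_partition lam"
  shows "of_nat (\<Sum>\<nu>\<in>partition_flags lam \<mu>. \<Prod>i<length \<mu>. hall_number q (\<nu> ! Suc i) (\<nu> ! i)) =
     of_nat q ^ n_stat lam * poly (flag_poly lam \<mu>) (1 / of_nat q)"
proof -
  define r where "r = length \<mu>"
  define t where "t = (1 / of_nat q :: rat)"
  have t: "t = q_inv q" using q by (simp add: t_def q_inv_def)
  have "of_nat (\<Prod>k<r. hall_number q (\<nu> ! Suc k) (\<nu> ! k)) =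
      of_nat q ^ n_stat lam * (t ^ c_stat r \<nu> *
        (\<Prod>k = 1..<r. \<Prod>i = 1..length (\<nu> ! r).
           poly (t_binomial (nth_part (\<nu> ! (k + 1)) i - nth_part (\<nu> ! k) (i + 1))
                      (nth_part (\<nu> ! k) i - nth_part (\<nu> ! k) (i + 1))) t))"
    if nu: "\<nu> \<in> partition_flags lam \<mu>" for \<nu>
  proof -
    define L where "L = length (\<nu> ! r)"
    define x where "x k i = nth_part (\<nu> ! k) i" for k i
    define T where "T k i = poly (t_binomial (x (Suc k) i - x k (Suc i)) (x k i - x k (Suc i))) t" for k i
    have top: "\<nu> ! r = conj_partition lam" and bot: "\<nu> ! 0 = []"
      and par: "\<And>k. k \<le> r \<Longrightarrow> is_partition (\<nu> ! k)"
      and con: "\<And>k. k < r \<Longrightarrow> part_contained (\<nu> ! k) (\<nu> ! Suc k)"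
      using nu by (auto simp: partition_flags_def r_def)
    have xle: "x k i \<le> x (Suc k) i" if "k < r" "1 \<le> i" for k i
      using con[OF that(1)] that(2) by (simp add: part_contained_def x_def)
    have lenle: "length (\<nu> ! k) \<le> length (\<nu> ! Suc k)" if "k < r" for k
    proof -
      have "dominated (\<nu> ! k) (\<nu> ! Suc k)"
        using con[OF that] par[of k] that part_contained_iff_dominated by simp
      then show ?thesis by (rule dominated_length)
    qed
    have len: "length (\<nu> ! k) \<le> L" if "k \<le> r" for k
      using that unfolding L_def by (induction k rule: inc_induct) (auto intro: order_trans lenle)
    have h: "of_nat (hall_number q (\<nu> ! Suc k) (\<nu> ! k)) =
        of_nat q ^ (\<Sum>i = 1..L. x k i * (x (Suc k) i - x k i)) * (\<Prod>i = 1..L. T k i)"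
      if "k < r" for k
      using hall_number_t_binomial[OF q, of "\<nu> ! k" "\<nu> ! Suc k" L] par[of k] con[of k] len[of "Suc k"] that
        part_contained_iff_dominated
      by (simp add: prod.distrib power_sum T_def x_def t)
    have "of_nat (\<Prod>k<r. hall_number q (\<nu> ! Suc k) (\<nu> ! k)) =
        of_nat q ^ (\<Sum>k<r. \<Sum>i = 1..L. x k i * (x (Suc k) i - x k i)) * (\<Prod>k<r. \<Prod>i = 1..L. T k i)"
      by (simp add: h prod.distrib power_sum)
    \<comment> \<open>The Hall numbers include the step from the empty partition, k = 0, whose
      binomials have lower index 0.\<close>
    also have "(\<Prod>k<r. \<Prod>i = 1..L. T k i) = (\<Prod>k = 1..<r. \<Prod>i = 1..L. T k i)"
    proof (rule prod.mono_neutral_right)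
      have "T 0 i = 1" for i by (simp add: T_def x_def bot)
      moreover have "k = 0" if "k \<in> {..<r} - {1..<r}" for k using that by auto
      ultimately show "\<forall>k\<in>{..<r} - {1..<r}. (\<Prod>i = 1..L. T k i) = 1" by fastforce
    qed auto
    \<comment> \<open>Column by column, \<open>choose_two_telescope\<close> is applied along k, from
      x 0 i = 0 up to x r i = lambda'_i.\<close>
    also have "of_nat q ^ (\<Sum>k<r. \<Sum>i = 1..L. x k i * (x (Suc k) i - x k i)) =
        of_nat q ^ n_stat lam * t ^ c_stat r \<nu>"
    proof -
      have "n_stat lam = (\<Sum>i = 1..L. count_ge lam i choose 2)"
        using lam partition_le_hd0[OF lam] unfolding L_def top length_conj_partition
        by (intro n_stat_eq_sum_choose) (auto simp: is_partition_def)
      also have "\<dots> = (\<Sum>i = 1..L. x r i choose 2)"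
      proof (rule sum.cong[OF refl])
        fix i assume "i \<in> {1..L}"
        then obtain j where "i = Suc j" by (cases i) auto
        then show "(count_ge lam i choose 2) = (x r i choose 2)"
          using nth_part_conj_partition[OF lam] by (simp add: x_def top)
      qed
      also have "\<dots> = (\<Sum>i = 1..L. (\<Sum>k<r. x k i * (x (Suc k) i - x k i)) +
          (\<Sum>k<r. (x (Suc k) i - x k i) choose 2))"
        by (intro sum.cong refl choose_two_telescope[where x = "\<lambda>k. x k _"])
          (use xle in \<open>auto simp: x_def bot\<close>)
      also have "\<dots> = (\<Sum>k<r. \<Sum>i = 1..L. x k i * (x (Suc k) i - x k i)) + c_stat r \<nu>"
        unfolding sum.distrib c_stat_def L_def[symmetric] by (simp add: x_def sum.swap[of _ _ "{..<r}"])
      finally have n: "n_stat lam = c_stat r \<nu> + (\<Sum>k<r. \<Sum>i = 1..L. x k i * (x (Suc k) i - x k i))"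
        by simp
      show ?thesis unfolding n t using q_power_q_inv_power[OF q] by simp
    qed
    finally show ?thesis by (simp add: T_def x_def L_def mult.assoc)
  qed
  then show ?thesis
    unfolding flag_poly_def r_def[symmetric] t_def[symmetric]
    by (simp add: poly_sum poly_prod poly_monom sum_distrib_left)
qed


section \<open>Matrices acting on coordinate vectors\<close>

context operator_space
begin

text \<open>By rank-nullity on N^i V, the ratio of the sizes for i and i + 1 is the size of its
  intersection with the kernel, namely q to the i-th entry.\<close>

lemma kernel_typeI:
  assumes "subspace V" "finite V" "0 \<notin> set p"
    and "\<And>i. card ((N ^^ i) ` V) = q ^ sum_list (drop i p)"
  shows "kernel_type p V"
  using assms
proof (induction p arbitrary: V)
  case Nil
  then have "card V = 1" using Nil(4)[of 0] by simp
  then show ?case using subspace_0[OF Nil(1)] by (auto simp: card_1_singleton_iff)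
next
  case (Cons a p)
  have cV: "card V = q ^ (a + sum_list p)" and cN: "card (N ` V) = q ^ sum_list p"
    using Cons.prems(4)[of 0] Cons.prems(4)[of 1] by auto
  have "V \<noteq> {0}"
  proof
    assume "V = {0}"
    then have "q ^ (a + sum_list p) = q ^ 0" using cV by simp
    then show False using Cons.prems(3) unfolding q_power_eq_iff by simp
  qed
  moreover have "card (V \<inter> ker) = q ^ a"
    using card_N_image[OF Cons.prems(1,2)] cV cN by (simp add: power_add)
  moreover have "kernel_type p (N ` V)"
  proof (rule Cons.IH)
    show "card ((N ^^ i) ` N ` V) = q ^ sum_list (drop i p)" for i
      using Cons.prems(4)[of "Suc i"] by (simp add: image_comp funpow_Suc_right del: funpow.simps)
  qed (use Cons.prems in \<open>auto intro: subspace_N_image\<close>)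
  ultimately show ?case by simp
qed

lemma kernel_type_from_kernels:
  assumes "subspace V" "finite V" "0 \<notin> set p" "card V = q ^ sum_list p"
    and ker: "\<And>i. card {v \<in> V. (N ^^ i) v = 0} = q ^ sum_list (take i p)"
  shows "kernel_type p V"
proof (rule kernel_typeI)
  fix i
  have add: "(N ^^ i) (x + y) = (N ^^ i) x + (N ^^ i) y" for x y
    by (induction i) (simp_all add: N_add)
  have scale: "(N ^^ i) (c *s x) = c *s (N ^^ i) x" for c x
    by (induction i) (simp_all add: N_scale)
  \<comment> \<open>Makes rank-nullity available for the i-th power, converting kernel sizes into
    image sizes.\<close>
  interpret pow: operator_space scale "N ^^ i"
    by unfold_locales (rule add scale)+
  have "V \<inter> pow.ker = {v \<in> V. (N ^^ i) v = 0}" by (auto simp: pow.ker_def)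
  then have "q ^ sum_list p = card ((N ^^ i) ` V) * q ^ sum_list (take i p)"
    using pow.card_N_image[OF assms(1,2)] ker[of i] assms(4) by simp
  moreover have "sum_list p = sum_list (drop i p) + sum_list (take i p)"
    by (metis add.commute append_take_drop_id sum_list_append)
  ultimately show "card ((N ^^ i) ` V) = q ^ sum_list (drop i p)"
    by (simp add: power_add)
qed (use assms in auto)

end

section \<open>Translating library dimensions into cardinalities\<close>

lemma card_vectorspace:
  fixes V :: "('a :: {field, finite}, 'v, 'm) module_scheme"
  assumes "vectorspace class_ring V" "finite (carrier V)"
  shows "card (carrier V) = card (UNIV :: 'a set) ^ vectorspace.dim class_ring V"
proof -
  interpret vectorspace "class_ring :: 'a ring" V by fact
  have "gen_set (carrier V)"
    using in_own_span[of "carrier V"] span_is_subset2[of "carrier V"] by auto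
  then have "fin_dim" unfolding fin_dim_def using assms(2) by blast
  then obtain B where B: "finite B" "basis B" using finite_basis_exists by blast
  then have BV: "B \<subseteq> carrier V" by (simp add: basis_def)
  have uniq: "\<exists>!a. a \<in> B \<rightarrow>\<^sub>E carrier class_ring \<and> lincomb a B = v" if "v \<in> carrier V" for v
    using basis_criterion[OF B(1) BV] B(2) that by blast
  have "bij_betw (\<lambda>a. lincomb a B) (B \<rightarrow>\<^sub>E carrier class_ring) (carrier V)"
    unfolding bij_betw_def
  proof
    have mem: "lincomb a B \<in> carrier V" if "a \<in> B \<rightarrow>\<^sub>E carrier class_ring" for a
      using that BV by (intro lincomb_closed) auto
    then show "inj_on (\<lambda>a. lincomb a B) (B \<rightarrow>\<^sub>E carrier class_ring)"
      using uniq by (intro inj_onI) metis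
    show "(\<lambda>a. lincomb a B) ` (B \<rightarrow>\<^sub>E carrier class_ring) = carrier V"
      using mem uniq by (auto simp: image_iff) metis
  qed
  then have "card (carrier V) = card (B \<rightarrow>\<^sub>E (carrier class_ring :: 'a set))"
    by (metis bij_betw_same_card)
  also have "\<dots> = card (UNIV :: 'a set) ^ card B" using B by (simp add: card_PiE class_ring_simps)
  finally show ?thesis using dim_basis[OF B] by simp
qed

lemma finite_carrier_vec: "finite (carrier_vec n :: 'a :: finite vec set)"
proof -
  have "carrier_vec n \<subseteq> vec_of_list ` {xs :: 'a list. set xs \<subseteq> UNIV \<and> length xs = n}"
  proof
    fix v :: "'a vec" assume "v \<in> carrier_vec n"
    then show "v \<in> vec_of_list ` {xs. set xs \<subseteq> UNIV \<and> length xs = n}"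
      by (intro image_eqI[of _ _ "list_of_vec v"]) (auto simp: vec_list)
  qed
  then show ?thesis by (rule finite_subset) (intro finite_imageI finite_lists_length_eq, simp)
qed

lemma card_carrier_vec: "card (carrier_vec n :: 'a :: {field, finite} vec set) = card (UNIV :: 'a set) ^ n"
proof -
  interpret vec_space "TYPE('a)" n .
  show ?thesis
    using card_vectorspace[OF vectorspace_axioms] dim_is_n by (simp add: finite_carrier_vec)
qed

lemma card_subspace_dim:
  fixes W :: "'a :: {field, finite} vec set"
  assumes "subspace class_ring W (module_vec TYPE('a) n)"
  shows "card W = card (UNIV :: 'a set) ^ subspace_dim n W"
proof -
  interpret vec_space "TYPE('a)" n .
  have "W \<subseteq> carrier_vec n"
    using assms submodule.subset[of class_ring W V] by (auto simp: subspace_def)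
  then have "finite W" using finite_carrier_vec by (rule finite_subset)
  then show ?thesis
    using card_vectorspace[OF subspace_is_vs[OF assms]] by (simp add: subspace_dim_def)
qed

lemma card_mat_kernel:
  fixes A :: "'a :: {field, finite} mat"
  shows "card (mat_kernel A) = card (UNIV :: 'a set) ^ kernel_dim A"
proof -
  interpret kernel "dim_row A" "dim_col A" A by unfold_locales auto
  have "finite (mat_kernel A)"
    using finite_carrier_vec by (rule finite_subset[rotated]) (auto simp: mat_kernel_def)
  then show ?thesis using card_vectorspace[OF Ker.vectorspace_axioms] by simp
qed

text \<open>The type \<open>'a vec\<close> mixes all dimensions and is no vector space; vectors are embedded into
  \<open>nat \<Rightarrow> 'a\<close>, extended by zero.\<close>

definition vec_emb :: "'a :: zero vec \<Rightarrow> nat \<Rightarrow> 'a" where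
  "vec_emb v = (\<lambda>i. if i < dim_vec v then v $ i else 0)"

definition fun_scale :: "'a :: times \<Rightarrow> (nat \<Rightarrow> 'a) \<Rightarrow> nat \<Rightarrow> 'a" where
  "fun_scale c f = (\<lambda>i. c * f i)"

lemma vec_vec_emb [simp]: "v \<in> carrier_vec n \<Longrightarrow> vec n (vec_emb v) = v"
  by (auto simp: vec_emb_def)

lemma vec_emb_vec: "(\<And>i. i \<ge> n \<Longrightarrow> f i = 0) \<Longrightarrow> vec_emb (vec n f) = f"
  by (auto simp: vec_emb_def fun_eq_iff not_less)

lemma inj_on_vec_emb: "inj_on vec_emb (carrier_vec n)"
  by (rule inj_on_inverseI[of _ "vec n"]) simp

lemma vec_emb_add: "v \<in> carrier_vec n \<Longrightarrow> w \<in> carrier_vec n \<Longrightarrow> vec_emb (v + w) = vec_emb v + vec_emb w"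
  for v w :: "'a :: monoid_add vec"
  by (auto simp: vec_emb_def fun_eq_iff)

lemma vec_emb_smult: "vec_emb (c \<cdot>\<^sub>v v) = fun_scale c (vec_emb v)" for v :: "'a :: mult_zero vec"
  by (auto simp: vec_emb_def fun_scale_def fun_eq_iff)

lemma vec_emb_0 [simp]: "vec_emb (0\<^sub>v n) = 0"
  by (auto simp: vec_emb_def fun_eq_iff)

lemma vec_emb_eq_0_iff: "v \<in> carrier_vec n \<Longrightarrow> vec_emb v = 0 \<longleftrightarrow> v = 0\<^sub>v n"
  using inj_onD[OF inj_on_vec_emb, of v "0\<^sub>v n" n] by auto

lemma vector_space_fun_scale: "vector_space (fun_scale :: 'a :: field \<Rightarrow> _)"
  by unfold_locales (auto simp: fun_scale_def fun_eq_iff algebra_simps)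

section \<open>The operator u - 1 on the embedded coordinate space\<close>

locale square_mat =
  fixes u :: "'a :: {field, finite} mat" and n :: nat
  assumes u: "u \<in> carrier_mat n n"
begin

definition "A = u - 1\<^sub>m n"

lemma A_carrier [simp]: "A \<in> carrier_mat n n"
  using u by (auto simp: A_def)

lemma A_pow_carrier [simp]: "A ^\<^sub>m i \<in> carrier_mat n n"
  by (rule pow_carrier_mat[OF A_carrier])

lemma A_mult_carrier: "v \<in> carrier_vec n \<Longrightarrow> A *\<^sub>v v \<in> carrier_vec n"
  by (rule mult_mat_vec_carrier[OF A_carrier])

text \<open>Only the first n coordinates are read, which makes N linear on all of
  \<open>nat \<Rightarrow> 'a\<close>; on the embedded space \<open>E\<close> it is the action of u
  - 1.\<close>

definition "N f = vec_emb (A *\<^sub>v vec n f)"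

sublocale operator_space fun_scale N
proof (intro operator_space.intro finite_field_space.intro vector_space_fun_scale operator_space_axioms.intro)
  fix x y :: "nat \<Rightarrow> 'a" and c :: 'a
  have "vec n (x + y) = vec n x + vec n y" by (auto simp: plus_fun_def)
  then show "N (x + y) = N x + N y"
    unfolding N_def by (simp add: mult_add_distrib_mat_vec[OF A_carrier] vec_emb_add[of _ n] A_mult_carrier)
  have "vec n (fun_scale c x) = c \<cdot>\<^sub>v vec n x" by (auto simp: fun_scale_def)
  then show "N (fun_scale c x) = fun_scale c (N x)"
    unfolding N_def by (simp add: mult_mat_vec[OF A_carrier] vec_emb_smult)
qed

definition "E = vec_emb ` (carrier_vec n :: 'a vec set)"

lemma E_eq: "E = {f :: nat \<Rightarrow> 'a. \<forall>i\<ge>n. f i = 0}"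
proof (intro equalityI subsetI)
  fix f :: "nat \<Rightarrow> 'a" assume "f \<in> {f. \<forall>i\<ge>n. f i = 0}"
  then have "f = vec_emb (vec n f)" using vec_emb_vec[of n f] by simp
  then show "f \<in> E" unfolding E_def by (intro image_eqI) auto
qed (auto simp: E_def vec_emb_def)

lemma N_vec_emb: "v \<in> carrier_vec n \<Longrightarrow> N (vec_emb v) = vec_emb (A *\<^sub>v v)"
  by (simp add: N_def)

lemma N_pow_vec_emb: "v \<in> carrier_vec n \<Longrightarrow> (N ^^ i) (vec_emb v) = vec_emb (A ^\<^sub>m i *\<^sub>v v)"
proof (induction i arbitrary: v)
  case (Suc i)
  have "(N ^^ Suc i) (vec_emb v) = (N ^^ i) (vec_emb (A *\<^sub>v v))"
    using Suc.prems by (simp add: funpow_swap1 N_vec_emb)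
  also have "\<dots> = vec_emb (A ^\<^sub>m i *\<^sub>v (A *\<^sub>v v))"
    using Suc A_mult_carrier by simp
  also have "A ^\<^sub>m i *\<^sub>v (A *\<^sub>v v) = (A ^\<^sub>m i * A) *\<^sub>v v"
    by (rule assoc_mult_mat_vec[symmetric, OF A_pow_carrier A_carrier Suc.prems])
  finally show ?case by simp
qed (simp add: carrier_matD[OF A_carrier])

lemma subspace_E: "subspace E"
  by (auto simp: subspace_def E_eq fun_scale_def)

lemma finite_E: "finite E"
  by (simp add: E_def finite_carrier_vec)

lemma invariant_E: "invariant E"
  unfolding invariant_def using subspace_E A_mult_carrier by (auto simp: E_def N_vec_emb)

lemma card_pow_kernel: "card {x \<in> E. (N ^^ i) x = 0} = q ^ dim_gen_eigenspace u 1 i"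
proof -
  have "char_matrix u 1 = A" unfolding char_matrix_def A_def using u by auto
  have "{x \<in> E. (N ^^ i) x = 0} = vec_emb ` mat_kernel (A ^\<^sub>m i)"
  proof -
    have "(N ^^ i) (vec_emb v) = 0 \<longleftrightarrow> A ^\<^sub>m i *\<^sub>v v = 0\<^sub>v n" if "v \<in> carrier_vec n" for v
      using N_pow_vec_emb[OF that] vec_emb_eq_0_iff[OF mult_mat_vec_carrier[OF A_pow_carrier that]]
      by simp
    then show ?thesis unfolding E_def mat_kernel[OF A_pow_carrier] by blast
  qed
  moreover have "inj_on vec_emb (mat_kernel (A ^\<^sub>m i))"
    by (rule inj_on_subset[OF inj_on_vec_emb mat_kernel_carrier[OF A_pow_carrier]])
  ultimately show ?thesis
    using card_mat_kernel[of "A ^\<^sub>m i"]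
    by (simp add: card_image dim_gen_eigenspace_def q_def \<open>char_matrix u 1 = A\<close>)
qed

text \<open>A unipotent Jordan block of size s contributes min(i, s) to the dimension of ker (u -
  1)^i, and these sums are the partial sums of the conjugate partition.\<close>

lemma kernel_type_E:
  assumes "is_partition lam" "has_type u lam" "sum_list lam = n"
  shows "kernel_type (conj_partition lam) E"
proof (rule kernel_type_from_kernels)
  have dim: "dim_gen_eigenspace u 1 i = sum_list (map (min i) lam)" for i
    using dim_gen_eigenspace[OF assms(2)[unfolded has_type_def], of 1 i]
    by (simp add: filter_map o_def)
  show "card {v \<in> E. (N ^^ i) v = 0} = q ^ sum_list (take i (conj_partition lam))" for i
    unfolding card_pow_kernel dim using sum_list_take_conj_partition[OF assms(1)] by simp
  have "card E = card (carrier_vec n :: 'a vec set)"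
    unfolding E_def by (rule card_image[OF inj_on_vec_emb])
  also have "\<dots> = q ^ n" by (simp add: card_carrier_vec q_def)
  finally show "card E = q ^ sum_list (conj_partition lam)"
    using sum_list_conj_partition[OF assms(1)] assms(3) by simp
qed (use subspace_E finite_E conj_partition_pos assms in auto)

lemma subspace_vec_emb_iff:
  assumes "W \<subseteq> carrier_vec n"
  shows "VectorSpace.subspace class_ring W (module_vec TYPE('a) n) \<longleftrightarrow> subspace (vec_emb ` W)"
proof
  {
    assume *: "VectorSpace.subspace class_ring W (module_vec TYPE('a) n)"
    then interpret S: submodule class_ring W "module_vec TYPE('a) n"
      by (simp add: VectorSpace.subspace_def)
    have W: "v + w \<in> W" "c \<cdot>\<^sub>v v \<in> W" "0\<^sub>v n \<in> W" if "v \<in> W" "w \<in> W" for v w c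
      using S.m_closed[of v w] S.smult_closed[of c v] S.zero_closed that
      by (auto simp: module_vec_simps class_ring_simps)
    have "0\<^sub>v n \<in> W" using S.zero_closed by (simp add: module_vec_simps)
    then show "subspace (vec_emb ` W)"
      unfolding subspace_def using W assms
      by (auto simp flip: vec_emb_add[of _ n] vec_emb_smult simp: subset_eq intro!: image_eqI[of 0 _ "0\<^sub>v n"])
  next
    assume S: "subspace (vec_emb ` W)"
    have mem: "v \<in> W" if "v \<in> carrier_vec n" "vec_emb v \<in> vec_emb ` W" for v
      using that assms inj_on_image_mem_iff[OF inj_on_vec_emb] by blast
    have "submodule class_ring W (module_vec TYPE('a) n)"
    proof (rule submodule.intro, rule vec_module)
      show "W \<subseteq> carrier (module_vec TYPE('a) n)" using assms by (simp add: module_vec_simps)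
      show "v \<oplus>\<^bsub>module_vec TYPE('a) n\<^esub> w \<in> W" if "v \<in> W" "w \<in> W" for v w
      proof -
        have vw: "v \<in> carrier_vec n" "w \<in> carrier_vec n" using that assms by auto
        have "vec_emb v + vec_emb w \<in> vec_emb ` W" using that by (intro subspace_add[OF S]) auto
        then show ?thesis
          using vw by (intro mem) (auto simp: module_vec_simps vec_emb_add[of _ n])
      qed
      show "\<zero>\<^bsub>module_vec TYPE('a) n\<^esub> \<in> W"
        using subspace_0[OF S] by (intro mem) (auto simp: module_vec_simps)
      show "c \<odot>\<^bsub>module_vec TYPE('a) n\<^esub> v \<in> W" if "v \<in> W" for c v
      proof -
        have "fun_scale c (vec_emb v) \<in> vec_emb ` W" using that by (intro subspace_scale[OF S]) auto
        then show ?thesis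
          using that assms by (intro mem) (auto simp: module_vec_simps vec_emb_smult)
      qed
    qed
    then show "VectorSpace.subspace class_ring W (module_vec TYPE('a) n)"
      using vec_vs by (simp add: VectorSpace.subspace_def)
  }
qed

text \<open>On a subspace, v and (u - 1) v lie in W together exactly when v and u v do. Inclusion of
  u W in W becomes equality because u is injective and W is finite.\<close>

lemma invariant_vec_emb_iff:
  assumes W: "W \<subseteq> carrier_vec n" and inv: "invertible_mat u"
  shows "VectorSpace.subspace class_ring W (module_vec TYPE('a) n) \<and> (\<lambda>v. u *\<^sub>v v) ` W = W \<longleftrightarrow>
    invariant (vec_emb ` W)"
proof -
  have Av: "A *\<^sub>v v = u *\<^sub>v v - v" if "v \<in> carrier_vec n" for v
    unfolding A_def using that u by (simp add: minus_mult_distrib_mat_vec)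
  have uv: "u *\<^sub>v v \<in> carrier_vec n" if "v \<in> carrier_vec n" for v
    using u that by (rule mult_mat_vec_carrier)
  have "N ` (vec_emb ` W) \<subseteq> vec_emb ` W \<longleftrightarrow> (\<lambda>v. u *\<^sub>v v) ` W = W"
    if S: "subspace (vec_emb ` W)"
  proof -
    have mem: "vec_emb v \<in> vec_emb ` W \<longleftrightarrow> v \<in> W" if "v \<in> carrier_vec n" for v
      using that W inj_on_image_mem_iff[OF inj_on_vec_emb] by blast
    have "N (vec_emb v) \<in> vec_emb ` W \<longleftrightarrow> u *\<^sub>v v \<in> W" if v: "v \<in> W" for v
    proof -
      have vc: "v \<in> carrier_vec n" using v W by auto
      have "w - v + v = w" if "w \<in> carrier_vec n" for w
        using vc that by (intro eq_vecI) auto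
      note this[OF uv[OF vc]]
      then have eq: "vec_emb (u *\<^sub>v v) = N (vec_emb v) + vec_emb v"
        using vc uv[OF vc] A_mult_carrier[OF vc]
        by (simp add: N_vec_emb Av flip: vec_emb_add[of _ n])
      have "u *\<^sub>v v \<in> W \<longleftrightarrow> N (vec_emb v) + vec_emb v \<in> vec_emb ` W"
        using mem[OF uv[OF vc]] eq by simp
      also have "\<dots> \<longleftrightarrow> N (vec_emb v) \<in> vec_emb ` W"
        using v subspace_add[OF S, of "N (vec_emb v)" "vec_emb v"]
          subspace_diff[OF S, of "N (vec_emb v) + vec_emb v" "vec_emb v"] by auto
      finally show ?thesis by simp
    qed
    then have "N ` (vec_emb ` W) \<subseteq> vec_emb ` W \<longleftrightarrow> (\<lambda>v. u *\<^sub>v v) ` W \<subseteq> W"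
      by (simp add: image_subset_iff)
    moreover have "(\<lambda>v. u *\<^sub>v v) ` W = W" if "(\<lambda>v. u *\<^sub>v v) ` W \<subseteq> W"
    proof (rule card_subset_eq)
      show "finite W" using W finite_carrier_vec by (rule finite_subset)
      obtain B where B: "u * B = 1\<^sub>m n" "B * u = 1\<^sub>m (dim_row B)"
        using inv u by (auto simp: invertible_mat_def inverts_mat_def)
      have "dim_col B = n" using arg_cong[OF B(1), of dim_col] by simp
      moreover have "dim_row B = n" using arg_cong[OF B(2), of dim_col] u by simp
      ultimately have Bc: "B \<in> carrier_mat n n" by (intro carrier_matI)
      have "B *\<^sub>v (u *\<^sub>v v) = v" if "v \<in> W" for v
        using that W B Bc u assoc_mult_mat_vec[OF Bc u, of v] by (auto simp: subset_eq)
      then have "inj_on (\<lambda>v. u *\<^sub>v v) W" by (rule inj_on_inverseI)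
      then show "card ((\<lambda>v. u *\<^sub>v v) ` W) = card W" by (rule card_image)
    qed (use that in auto)
    ultimately show ?thesis by auto
  qed
  then show ?thesis unfolding invariant_def subspace_vec_emb_iff[OF W] by blast
qed

text \<open>Prepending the zero space supplies the member with index 0; every other index shifts by
  one.\<close>

lemma fixed_flags_iff:
  assumes inv: "invertible_mat u" and sum: "sum_list \<mu> = n"
    and Vs: "\<And>W. W \<in> set Vs \<Longrightarrow> W \<subseteq> carrier_vec n"
  shows "Vs \<in> fixed_flags u \<mu> \<longleftrightarrow> {0} # map (image vec_emb) Vs \<in> invariant_flags \<mu> E"
proof (cases "length Vs = length \<mu>")
  case False
  then show ?thesis by (auto simp: fixed_flags_def mu_flags_def invariant_flags_def)
next
  case l: True
  have dr: "dim_row u = n" using u by auto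
  let ?Us = "{0} # map (image vec_emb) Vs"
  have sub: "Vs ! i \<subseteq> carrier_vec n" if "i < length \<mu>" for i
    using Vs that l by auto
  have split: "(\<forall>i\<le>length \<mu>. P (?Us ! i) i) \<longleftrightarrow> P {0} 0 \<and> (\<forall>i<length \<mu>. P (vec_emb ` (Vs ! i)) (Suc i))" for P
    unfolding less_Suc_eq_le[symmetric] All_less_Suc2 using l by auto
  have 1: "VectorSpace.subspace class_ring (Vs ! i) (module_vec TYPE('a) n) \<and>
        (\<lambda>v. u *\<^sub>v v) ` (Vs ! i) = Vs ! i \<and> subspace_dim n (Vs ! i) = sum_list (take (i + 1) \<mu>) \<longleftrightarrow>
      invariant (vec_emb ` (Vs ! i)) \<and> card (vec_emb ` (Vs ! i)) = q ^ sum_list (take (Suc i) \<mu>)"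
    if "i < length \<mu>" for i
  proof -
    have "card (vec_emb ` (Vs ! i)) = card (Vs ! i)"
      by (rule card_image[OF inj_on_subset[OF inj_on_vec_emb sub[OF that]]])
    moreover have "card (Vs ! i) = q ^ subspace_dim n (Vs ! i)"
      if "VectorSpace.subspace class_ring (Vs ! i) (module_vec TYPE('a) n)"
      using card_subspace_dim[OF that] by (simp add: q_def)
    ultimately show ?thesis
      using invariant_vec_emb_iff[OF sub[OF that] inv] by (auto simp: q_power_eq_iff)
  qed
  have 2: "(\<forall>i. i + 1 < length \<mu> \<longrightarrow> Vs ! i \<subseteq> Vs ! (i + 1)) \<longleftrightarrow> (\<forall>i<length \<mu>. ?Us ! i \<subseteq> ?Us ! Suc i)"
    if inv: "\<forall>i<length \<mu>. invariant (vec_emb ` (Vs ! i))"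
  proof -
    have "(\<forall>i<length \<mu>. ?Us ! i \<subseteq> ?Us ! Suc i) \<longleftrightarrow>
        (\<forall>i. i + 1 < length \<mu> \<longrightarrow> ?Us ! Suc i \<subseteq> ?Us ! Suc (Suc i))"
    proof -
      have "?Us ! 0 \<subseteq> ?Us ! Suc 0" if "0 < length \<mu>"
        using inv that l by (auto simp: invariant_def subspace_0)
      then have "?Us ! i \<subseteq> ?Us ! Suc i" if "i < length \<mu>"
        "\<forall>i. i + 1 < length \<mu> \<longrightarrow> ?Us ! Suc i \<subseteq> ?Us ! Suc (Suc i)" for i
        using that by (cases i) (simp_all only: add.commute plus_1_eq_Suc)
      then show ?thesis by (metis Suc_eq_plus1)
    qed
    also have "\<dots> \<longleftrightarrow> (\<forall>i. i + 1 < length \<mu> \<longrightarrow> Vs ! i \<subseteq> Vs ! (i + 1))"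
    proof -
      have "vec_emb ` (Vs ! i) \<subseteq> vec_emb ` (Vs ! j) \<longleftrightarrow> Vs ! i \<subseteq> Vs ! j"
        if "i < length \<mu>" "j < length \<mu>" for i j
        using inj_on_image_mem_iff[OF inj_on_vec_emb _ sub[OF that(2)]] sub[OF that(1)]
        by (auto simp: subset_eq)
      then show ?thesis using l by auto
    qed
    finally show ?thesis by blast
  qed
  \<comment> \<open>For an empty composition n = 0, so \<open>E\<close> is the zero space and
    coincides with the prepended member.\<close>
  have 3: "(\<mu> \<noteq> [] \<longrightarrow> last Vs = carrier_vec n) \<longleftrightarrow> last ?Us = E"
  proof (cases "\<mu> = []")
    case True
    then have "n = 0" using sum by simp
    then have "E = {0}" using E_eq by (auto simp: fun_eq_iff)
    then show ?thesis using True l by simp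
  next
    case False
    then have ne: "Vs \<noteq> []" using l by auto
    then have "last Vs \<subseteq> carrier_vec n" using Vs by simp
    then show ?thesis
      using False ne inj_on_image_eq_iff[OF inj_on_vec_emb, of "last Vs" n "carrier_vec n"]
      by (simp add: last_map E_def)
  qed
  have "Vs \<in> fixed_flags u \<mu> \<longleftrightarrow>
      (\<forall>i<length \<mu>. VectorSpace.subspace class_ring (Vs ! i) (module_vec TYPE('a) n) \<and>
        (\<lambda>v. u *\<^sub>v v) ` (Vs ! i) = Vs ! i \<and> subspace_dim n (Vs ! i) = sum_list (take (i + 1) \<mu>)) \<and>
      (\<forall>i. i + 1 < length \<mu> \<longrightarrow> Vs ! i \<subseteq> Vs ! (i + 1)) \<and> (\<mu> \<noteq> [] \<longrightarrow> last Vs = carrier_vec n)"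
    unfolding fixed_flags_def mu_flags_def dr mem_Collect_eq all_set_conv_all_nth l by blast
  also have "\<dots> \<longleftrightarrow>
      (\<forall>i<length \<mu>. invariant (vec_emb ` (Vs ! i)) \<and> card (vec_emb ` (Vs ! i)) = q ^ sum_list (take (Suc i) \<mu>)) \<and>
      (\<forall>i<length \<mu>. ?Us ! i \<subseteq> ?Us ! Suc i) \<and> last ?Us = E"
  \<comment> \<open>The inclusion conditions agree only for subspaces, as the zero space must lie in
    the first member; hence the congruence rule, which lets fact 2 assume invariance.\<close>
  proof (rule conj_cong)
    assume "\<forall>i<length \<mu>. invariant (vec_emb ` (Vs ! i)) \<and> card (vec_emb ` (Vs ! i)) = q ^ sum_list (take (Suc i) \<mu>)"
    then have "\<forall>i<length \<mu>. invariant (vec_emb ` (Vs ! i))" by simp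
    then show "(\<forall>i. i + 1 < length \<mu> \<longrightarrow> Vs ! i \<subseteq> Vs ! (i + 1)) \<and> (\<mu> \<noteq> [] \<longrightarrow> last Vs = carrier_vec n) \<longleftrightarrow>
        (\<forall>i<length \<mu>. ?Us ! i \<subseteq> ?Us ! Suc i) \<and> last ?Us = E"
      unfolding 3 by (simp only: 2)
  qed (rule all_cong1, rule imp_cong[OF refl], rule 1)
  also have "\<dots> \<longleftrightarrow> ?Us \<in> invariant_flags \<mu> E"
    unfolding invariant_flags_def mem_Collect_eq split[where P = "\<lambda>X i. invariant X \<and> card X = q ^ sum_list (take i \<mu>)"]
    using l invariant_0 by simp
  finally show ?thesis .
qed

text \<open>The inverse map drops the head and restricts functions to n coordinates. It applies to
  every stable flag because all members lie below the last one, \<open>E\<close>, and the head,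
  having size 1, is the zero space.\<close>

lemma card_fixed_flags:
  assumes inv: "invertible_mat u" and sum: "sum_list \<mu> = n"
  shows "card (fixed_flags u \<mu>) = card (invariant_flags \<mu> E)"
proof -
  let ?f = "\<lambda>Vs. {0} # map (image vec_emb) Vs"
  have dr: "dim_row u = n" using u by auto
  have sub: "W \<subseteq> carrier_vec n" if Vs: "Vs \<in> fixed_flags u \<mu>" and W: "W \<in> set Vs" for Vs W
  proof -
    have "length Vs = length \<mu>" using Vs by (simp add: fixed_flags_def mu_flags_def)
    with W obtain i where "i < length \<mu>" "W = Vs ! i"
      by (auto simp: in_set_conv_nth)
    then have "VectorSpace.subspace class_ring W (module_vec TYPE('a) n)"
      using Vs by (auto simp: fixed_flags_def mu_flags_def dr)
    then show ?thesis
      using submodule.subset[of class_ring W "module_vec TYPE('a) n"]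
      by (auto simp: VectorSpace.subspace_def module_vec_simps)
  qed
  have "?f ` fixed_flags u \<mu> = invariant_flags \<mu> E"
  proof (intro equalityI subsetI)
    fix Us assume "Us \<in> ?f ` fixed_flags u \<mu>"
    then show "Us \<in> invariant_flags \<mu> E"
      using fixed_flags_iff[OF inv sum] sub by blast
  next
    fix Us assume Us: "Us \<in> invariant_flags \<mu> E"
    then obtain X Xs where UX: "Us = X # Xs" by (cases Us) (auto simp: invariant_flags_def)
    have "card X = 1" "subspace X"
      using Us UX by (force simp: invariant_flags_def invariant_def)+
    then have X: "X = {0}" using subspace_0 by (auto simp: card_1_singleton_iff)
    have XE: "Y \<subseteq> E" if Y: "Y \<in> set Us" for Y
    proof -
      have l: "length Us = Suc (length \<mu>)" and "last Us = E"
        using Us by (simp_all add: invariant_flags_def)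
      then have last: "Us ! length \<mu> = E" by (cases "Us = []") (auto simp: last_conv_nth)
      obtain i where i: "i \<le> length \<mu>" "Y = Us ! i"
        using Y l by (auto simp: in_set_conv_nth less_Suc_eq_le)
      then show ?thesis
        using nth_chain_mono[of "Suc (length \<mu>)" Us i "length \<mu>"] Us last
        by (auto simp: invariant_flags_def)
    qed
    define Vs where "Vs = map (image (vec n)) Xs"
    have "vec_emb ` (vec n ` Y) = Y" if "Y \<subseteq> E" for Y
    proof -
      have "vec_emb (vec n f) = f" if "f \<in> Y" for f
        using that \<open>Y \<subseteq> E\<close> by (intro vec_emb_vec) (auto simp: E_eq)
      then show ?thesis by (simp add: image_image)
    qed
    then have fV: "?f Vs = Us"
      using XE by (auto simp: UX X Vs_def o_def intro!: map_idI)
    have "Vs \<in> fixed_flags u \<mu>"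
    proof (subst fixed_flags_iff[OF inv sum])
      show "?f Vs \<in> invariant_flags \<mu> E" using Us fV by simp
    qed (auto simp: Vs_def)
    then show "Us \<in> ?f ` fixed_flags u \<mu>" using fV by blast
  qed
  moreover have "inj_on ?f (fixed_flags u \<mu>)"
  proof (rule inj_on_inverseI[of _ "\<lambda>Us. map (image (vec n)) (tl Us)"])
    fix Vs assume Vs: "Vs \<in> fixed_flags u \<mu>"
    have "vec n ` vec_emb ` W = W" if "W \<in> set Vs" for W
    proof -
      have "vec n (vec_emb v) = v" if "v \<in> W" for v
        using that sub[OF Vs \<open>W \<in> set Vs\<close>] by (intro vec_vec_emb) auto
      then show ?thesis by (simp add: image_image)
    qed
    then show "map (image (vec n)) (tl (?f Vs)) = Vs" by (auto simp: o_def intro!: map_idI)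
  qed
  ultimately show ?thesis by (metis card_image)
qed

end

theorem mainTheorem3:
  fixes u :: "'a :: {field, finite} mat"
    and q n :: nat
    and lam \<mu> :: "nat list"
  assumes "q = card (UNIV :: 'a set)"
    and "is_partition lam" and "sum_list lam = n"
    and "sum_list \<mu> = n"
    and "u \<in> carrier_mat n n" and "invertible_mat u"
    and "unipotent_mat u" and "has_type u lam"
  shows "of_nat (card (fixed_flags u \<mu>)) =
           of_nat q ^ n_stat lam * poly (flag_poly lam \<mu>) (1 / of_nat q)"
proof -
  interpret M: square_mat u n by unfold_locales fact
  have "q = M.q" unfolding M.q_def by fact
  have "card (fixed_flags u \<mu>) = card (M.invariant_flags \<mu> M.E)"
    using assms by (intro M.card_fixed_flags)
  also have "\<dots> = (\<Sum>\<nu>\<in>partition_flags lam \<mu>. \<Prod>i<length \<mu>. hall_number q (\<nu> ! Suc i) (\<nu> ! i))"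
    unfolding \<open>q = M.q\<close> using assms M.invariant_E M.finite_E M.kernel_type_E
    by (intro M.card_invariant_flags) auto
  finally show ?thesis
    using flag_sum_eq[of q lam \<mu>] M.q_ge_2 assms(2) \<open>q = M.q\<close> by simp
qed

end
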